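(* Let $p$ be an odd prime and let $G$ be an extra-special $p$-group of exponent $p$. Then $G$ is a favorable $p$-group; that is, there is a non-identity automorphism $\phi$ of $G$ of order coprime to $p$ such that for every proper subgroup $H$ of $G$ with $\phi(H)=H$ one has $\phi(h)=h$ for all $h\in H$.
   Context: All groups are finite. An extra-special $p$-group is a $p$-group $G$ with $G'=\mathcal{Z}(G)=\Phi(G)$ cyclic of order $p$, where $G'$ is the commutator subgroup, $\mathcal{Z}(G)$ the center and $\Phi(G)$ the Frattini subgroup. When $p$ is odd and $G$ has exponent $p$, $G$ has order $p^{2n+1}$ for some integer $n\ge 1$ and is the central product of $n$ copies of the group $\langle x,y,z \mid x^p=y^p=z^p=1,\ [x,z]=[y,z]=1,\ [x,y]=z\rangle$ of order $p^3$. A $p'$-automorphism of a $p$-group is an automorphism whose order is coprime to $p$. A $p$-group $G$ is called favorable if there is a non-identity $p'$-automorphism $\phi$ of $G$ such that, whenever $\phi$ fixes (setwise) a proper subgroup $H$ of $G$, it restricts to the identity on $H$. *)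

theory Defs
  imports "HOL-Algebra.Algebra" "HOL-Computational_Algebra.Primes"
begin

definition p_group :: "nat \<Rightarrow> ('a, 'b) monoid_scheme \<Rightarrow> bool" where
  "p_group p G \<longleftrightarrow> Factorial_Ring.prime p \<and> group G \<and> finite (carrier G) \<and> (\<exists>n. order G = p ^ n)"

definition center :: "('a, 'b) monoid_scheme \<Rightarrow> 'a set" where
  "center G = {z \<in> carrier G. \<forall>g \<in> carrier G. z \<otimes>\<^bsub>G\<^esub> g = g \<otimes>\<^bsub>G\<^esub> z}"

definition maximal_subgroup :: "'a set \<Rightarrow> ('a, 'b) monoid_scheme \<Rightarrow> bool" where
  "maximal_subgroup M G \<longleftrightarrow> subgroup M G \<and> M \<noteq> carrier G \<and>
     (\<forall>K. subgroup K G \<and> M \<subseteq> K \<longrightarrow> K = M \<or> K = carrier G)"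

text \<open>The intersection with the carrier only matters when there is no maximal subgroup,
  that is, for the trivial group, where the empty intersection would be the whole type.\<close>

definition frattini :: "('a, 'b) monoid_scheme \<Rightarrow> 'a set" where
  "frattini G = carrier G \<inter> \<Inter> {M. maximal_subgroup M G}"

definition group_exponent :: "('a, 'b) monoid_scheme \<Rightarrow> nat" where
  "group_exponent G = (LEAST n. 0 < n \<and> (\<forall>x \<in> carrier G. x [^]\<^bsub>G\<^esub> n = \<one>\<^bsub>G\<^esub>))"

definition extra_special :: "nat \<Rightarrow> ('a, 'b) monoid_scheme \<Rightarrow> bool" where
  "extra_special p G \<longleftrightarrow> p_group p G \<and>
     derived G (carrier G) = center G \<and> center G = frattini G \<and>
     cyclic_group (G\<lparr>carrier := derived G (carrier G)\<rparr>) \<and>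
     order (G\<lparr>carrier := derived G (carrier G)\<rparr>) = p"

text \<open>The elements of \<^term>\<open>auto G\<close> are extensional functions, so the identity automorphism
  is \<^term>\<open>\<one>\<^bsub>AutoGroup G\<^esub>\<close>, the identity restricted to the carrier. On a finite group every
  automorphism has positive order.\<close>

definition coprime_automorphism ::
    "nat \<Rightarrow> ('a, 'b) monoid_scheme \<Rightarrow> ('a \<Rightarrow> 'a) \<Rightarrow> bool" where
  "coprime_automorphism p G \<phi> \<longleftrightarrow>
     \<phi> \<in> carrier (AutoGroup G) \<and> coprime (group.ord (AutoGroup G) \<phi>) p"

definition favorable :: "nat \<Rightarrow> ('a, 'b) monoid_scheme \<Rightarrow> bool" where
  "favorable p G \<longleftrightarrow> p_group p G \<and>
     (\<exists>\<phi>. coprime_automorphism p G \<phi> \<and> \<phi> \<noteq> \<one>\<^bsub>AutoGroup G\<^esub> \<and>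
       (\<forall>H. subgroup H G \<and> H \<noteq> carrier G \<and> \<phi> ` H = H \<longrightarrow> (\<forall>h \<in> H. \<phi> h = h)))"

end

theory Submission
  imports Defs "HOL-Number_Theory.Residues"
begin

text \<open>
  An extra-special group of exponent \<open>p\<close> has order \<open>p ^ (2 * n + 1)\<close> and is determined up to isomorphism
  by its order: splitting off a pair of noncommuting elements leaves their centralizer, a smaller group of
  the same kind. So it suffices to treat the Heisenberg group on \<open>K \<times> \<int>/p\<close>, where \<open>K\<close> is the field
  with \<open>q\<^sup>2 = p ^ (2 * n)\<close> elements, \<open>q = p ^ n\<close>, and the cocycle is an alternating form
  \<open>T (x y\<^sup>q - x\<^sup>q y)\<close> with \<open>T\<close> an additive functional on \<open>K\<close>. Multiplication by an element \<open>u\<close> of order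
  \<open>q + 1\<close> preserves the form, hence gives an automorphism of order \<open>q + 1\<close> that is trivial on the center
  and acts irreducibly on \<open>K\<close>. An invariant subgroup therefore either lies in the center, where the
  automorphism is trivial, or maps onto \<open>K\<close>, in which case it contains a nontrivial commutator,
  hence the center, and is the whole group.
\<close>

subsection \<open>Splitting off hyperbolic pairs\<close>

text \<open>The automorphism needs a formula, and only the concrete model supplies one; hence the
  detour through uniqueness. Exponent \<open>p\<close> is what makes the order a complete invariant:
  elements are written \<open>y^j x^i c\<close> with \<open>c\<close> centralizing the pair, and
  since \<open>x^p = y^p = 1\<close> the product depends on \<open>i\<close>, \<open>j\<close>
  modulo \<open>p\<close>, on a factor \<open>z^(i l)\<close>, and on the product inside the
  centralizer. Two groups of equal order are then compared term by term. The order
  \<open>q + 1\<close> plays three roles. The equation \<open>u * u^q = 1\<close> is the condition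
  under which scaling by \<open>u\<close> preserves the form; \<open>q + 1\<close> is prime to
  \<open>p\<close>; and \<open>q + 1\<close> does not divide \<open>p^d - 1\<close> for
  \<open>0 < d < 2n\<close>, so no proper subring of \<open>K\<close> contains \<open>u\<close>. Odd
  \<open>p\<close> enters through the factor 2: with an alternating cocycle a commutator in the
  model is twice the value of \<open>T\<close> on the form. For \<open>p = 2\<close> such a cocycle
  would be symmetric and the model abelian. The functional \<open>T\<close> cannot be the field
  trace, because the form takes values of trace zero.\<close>

lemma (in group) pow_mod_exponent:
  fixes p :: nat
  assumes "x \<in> carrier G" "x [^] p = \<one>"
  shows "x [^] (i mod p) = x [^] i"
proof -
  have "x [^] i = x [^] (i mod p + p * (i div p))"
    by simp
  also have "\<dots> = x [^] (i mod p) \<otimes> (x [^] p) [^] (i div p)"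
    using assms(1) by (simp add: nat_pow_mult nat_pow_pow del: mod_mult_div_eq)
  finally show ?thesis
    using assms by simp
qed

text \<open>The cyclic group of order \<open>p\<close> is included, as the base case of inductions.\<close>
locale special_p_group = group G for G (structure) +
  fixes p :: nat and z
  assumes prime: "Factorial_Ring.prime p"
    and finite_carrier: "finite (carrier G)"
    and exponent: "x \<in> carrier G \<Longrightarrow> x [^] p = \<one>"
    and z_closed [simp, intro]: "z \<in> carrier G"
    and z_nontrivial: "z \<noteq> \<one>"
    and z_central: "x \<in> carrier G \<Longrightarrow> z \<otimes> x = x \<otimes> z"
    and commutator: "\<lbrakk>x \<in> carrier G; y \<in> carrier G\<rbrakk> \<Longrightarrow> \<exists>i::nat. x \<otimes> y = y \<otimes> x \<otimes> z [^] i"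
    and central: "\<lbrakk>c \<in> carrier G; \<And>x. x \<in> carrier G \<Longrightarrow> c \<otimes> x = x \<otimes> c\<rbrakk> \<Longrightarrow> \<exists>i::nat. c = z [^] i"
begin

lemma pow_mod: "x \<in> carrier G \<Longrightarrow> x [^] (i mod p) = x [^] i"
  using exponent by (intro pow_mod_exponent)

lemma pow_cong: "\<lbrakk>x \<in> carrier G; i mod p = j mod p\<rbrakk> \<Longrightarrow> x [^] i = x [^] j"
  by (metis pow_mod)

lemma ord_z: "ord z = p"
proof -
  have "ord z dvd p"
    using exponent pow_eq_id by blast
  with ord_eq_1[of z] show ?thesis
    using prime z_closed z_nontrivial by (metis prime_nat_iff)
qed

lemma z_pow_eq_iff: "z [^] (i::nat) = z [^] j \<longleftrightarrow> i mod p = j mod p"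
proof
  assume eq: "z [^] i = z [^] j"
  have "z [^] (int i) = z [^] (int j)"
    using eq by (simp add: int_pow_int)
  then have "int p dvd int j - int i"
    by (simp add: int_pow_eq ord_z)
  then show "i mod p = j mod p"
    by (metis mod_eq_dvd_iff of_nat_eq_iff zmod_int)
qed (auto intro: pow_cong)

lemma pow_commutes: "x \<in> carrier G \<Longrightarrow> x \<otimes> x [^] (k::nat) = x [^] k \<otimes> x"
  by (metis nat_pow_Suc nat_pow_Suc2)

lemma zpow_central: "x \<in> carrier G \<Longrightarrow> z [^] (i::nat) \<otimes> x = x \<otimes> z [^] i"
proof (induction i)
  case (Suc i)
  have "z [^] Suc i \<otimes> x = (z [^] i \<otimes> x) \<otimes> z"
    using Suc.prems by (simp add: m_assoc z_central)
  also have "\<dots> = x \<otimes> z [^] Suc i"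
    unfolding Suc.IH[OF Suc.prems] using Suc.prems by (simp add: m_assoc)
  finally show ?case .
qed simp

text \<open>Since \<open>z\<close> is central, the exponent of \<open>z\<close> picked up in
  swapping two elements adds up over a product. This is bilinearity of the commutator form on the
  quotient by the powers of \<open>z\<close>, stated without inverses so that natural exponents
  suffice; exponent 0 expresses commuting.\<close>

lemma commutator_mult_right:
  assumes "a \<in> carrier G" "b \<in> carrier G" "c \<in> carrier G"
    and "a \<otimes> b = b \<otimes> a \<otimes> z [^] (i::nat)" "a \<otimes> c = c \<otimes> a \<otimes> z [^] (j::nat)"
  shows "a \<otimes> (b \<otimes> c) = (b \<otimes> c) \<otimes> a \<otimes> z [^] (i + j)"
proof -
  have "a \<otimes> (b \<otimes> c) = b \<otimes> a \<otimes> z [^] i \<otimes> c"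
    using assms by (simp flip: m_assoc)
  also have "\<dots> = b \<otimes> (a \<otimes> c) \<otimes> z [^] i"
    using assms(1-3) by (simp add: m_assoc zpow_central)
  also have "\<dots> = (b \<otimes> c) \<otimes> a \<otimes> (z [^] j \<otimes> z [^] i)"
    using assms by (simp add: m_assoc)
  finally show ?thesis
    by (simp add: nat_pow_mult add.commute)
qed

lemma commutator_mult_left:
  assumes "a \<in> carrier G" "b \<in> carrier G" "c \<in> carrier G"
    and "b \<otimes> a = a \<otimes> b \<otimes> z [^] (i::nat)" "c \<otimes> a = a \<otimes> c \<otimes> z [^] (j::nat)"
  shows "(b \<otimes> c) \<otimes> a = a \<otimes> (b \<otimes> c) \<otimes> z [^] (i + j)"
proof -
  have "(b \<otimes> c) \<otimes> a = b \<otimes> (a \<otimes> c \<otimes> z [^] j)"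
    using assms(1-3) by (simp add: m_assoc flip: assms(5))
  also have "\<dots> = (b \<otimes> a) \<otimes> c \<otimes> z [^] j"
    using assms(1-3) by (simp add: m_assoc)
  also have "\<dots> = a \<otimes> b \<otimes> (z [^] i \<otimes> c) \<otimes> z [^] j"
    unfolding assms(4) using assms(1-3) by (simp add: m_assoc)
  also have "\<dots> = a \<otimes> (b \<otimes> c) \<otimes> (z [^] i \<otimes> z [^] j)"
    unfolding zpow_central[OF assms(3)] using assms(1-3) by (simp add: m_assoc)
  finally show ?thesis
    by (simp add: nat_pow_mult)
qed

lemma commutator_pow_right:
  assumes "a \<in> carrier G" "b \<in> carrier G" "a \<otimes> b = b \<otimes> a \<otimes> z [^] (i::nat)"
  shows "a \<otimes> b [^] k = b [^] k \<otimes> a \<otimes> z [^] (i * k)"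
proof (induction k)
  case (Suc k)
  from commutator_mult_right[OF assms(1) _ assms(2) Suc assms(3)] show ?case
    using assms(2) by (simp add: add.commute)
qed (use assms in simp)

lemma commutator_pow_left:
  assumes "a \<in> carrier G" "b \<in> carrier G" "b \<otimes> a = a \<otimes> b \<otimes> z [^] (i::nat)"
  shows "b [^] k \<otimes> a = a \<otimes> b [^] k \<otimes> z [^] (i * k)"
proof (induction k)
  case (Suc k)
  from commutator_mult_left[OF assms(1) _ assms(2) Suc assms(3)] show ?case
    using assms(2) by (simp add: add.commute)
qed (use assms in simp)

text \<open>A hyperbolic pair of the symplectic commutator form, with commutator normalised to
  \<open>z\<close> itself, so that pairs in two groups satisfy the same relation. The centralizer
  defined next corresponds to the orthogonal complement of the pair.\<close>

definition hyperbolic :: "'a \<Rightarrow> 'a \<Rightarrow> bool" where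
  "hyperbolic x y \<longleftrightarrow> x \<in> carrier G \<and> y \<in> carrier G \<and> x \<otimes> y = y \<otimes> x \<otimes> z"

definition pair_centralizer :: "'a \<Rightarrow> 'a \<Rightarrow> 'a set" where
  "pair_centralizer x y = {c \<in> carrier G. c \<otimes> x = x \<otimes> c \<and> c \<otimes> y = y \<otimes> c}"

text \<open>A non-central \<open>x\<close> has some \<open>y\<close> with commutator
  \<open>z^i\<close> and \<open>i\<close> prime to \<open>p\<close>; replacing \<open>y\<close> by
  its power with exponent an inverse of \<open>i\<close> modulo \<open>p\<close> normalises the
  commutator to \<open>z\<close>.\<close>

lemma exists_hyperbolic:
  assumes "carrier G \<noteq> range (\<lambda>i::nat. z [^] i)"
  obtains x y where "hyperbolic x y"
proof -
  have "\<exists>c\<in>carrier G. \<not> (\<exists>i::nat. c = z [^] i)"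
    using assms by auto
  then obtain x y where x: "x \<in> carrier G" and y: "y \<in> carrier G" and ne: "x \<otimes> y \<noteq> y \<otimes> x"
    using central by blast
  obtain i :: nat where i: "x \<otimes> y = y \<otimes> x \<otimes> z [^] i"
    using commutator x y by blast
  have "\<not> p dvd i"
  proof
    assume "p dvd i"
    then have "z [^] i = \<one>"
      by (simp add: ord_z pow_eq_id)
    then show False using i ne x y by simp
  qed
  then have "coprime i p"
    using prime prime_imp_coprime coprime_commute by blast
  then obtain k where "[i * k = 1] (mod p)"
    using cong_solve_coprime_nat by auto
  then have "z [^] (i * k) = z"
    by (metis cong_def nat_pow_eone pow_cong z_closed)
  with commutator_pow_right[OF x y i, of k] have "hyperbolic x (y [^] k)"
    using x y by (simp add: hyperbolic_def)
  then show thesis by (rule that)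
qed

lemma subgroup_pair_centralizer:
  assumes "x \<in> carrier G" "y \<in> carrier G"
  shows "subgroup (pair_centralizer x y) G"
proof (rule subgroupI)
  fix a assume a: "a \<in> pair_centralizer x y"
  then show "inv a \<in> pair_centralizer x y"
    unfolding pair_centralizer_def using assms
    by (auto simp: inv_solve_left inv_solve_right m_assoc) 
next
  fix a b assume "a \<in> pair_centralizer x y" "b \<in> pair_centralizer x y"
  then show "a \<otimes> b \<in> pair_centralizer x y"
    unfolding pair_centralizer_def using assms
    by (auto simp: m_assoc) (metis m_assoc)+
next
  show "pair_centralizer x y \<noteq> {}"
    using assms by (auto simp: pair_centralizer_def intro!: exI[of _ \<one>])
qed (auto simp: pair_centralizer_def)

section \<open>Normal forms relative to one hyperbolic pair\<close>

context
  fixes x y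
  assumes xy: "hyperbolic x y"
begin

lemma hyperbolic_closed [simp]: "x \<in> carrier G" "y \<in> carrier G"
  using xy by (auto simp: hyperbolic_def)

lemma pair_centralizer_closed: "c \<in> pair_centralizer x y \<Longrightarrow> c \<in> carrier G"
  by (simp add: pair_centralizer_def)

lemma z_in_pair_centralizer: "z [^] (i::nat) \<in> pair_centralizer x y"
  by (simp add: pair_centralizer_def zpow_central)

text \<open>The exponent \<open>i\<close> is read off the commutator of \<open>g\<close> with
  \<open>y\<close>, and \<open>j\<close> off that of \<open>x\<close> with \<open>g\<close>.
  Multiplying \<open>g\<close> on the left by the inverses of \<open>y^j\<close> and
  \<open>x^i\<close> cancels both commutators, so what remains centralizes the pair.\<close>

lemma normal_form_exists:
  assumes g: "g \<in> carrier G"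
  obtains i j c where "i < p" "j < p" "c \<in> pair_centralizer x y" "g = y [^] (j::nat) \<otimes> x [^] (i::nat) \<otimes> c"
proof -
  have p0: "p > 0" using prime prime_gt_0_nat by blast
  have xy1: "x \<otimes> y = y \<otimes> x \<otimes> z [^] (1::nat)"
    using xy by (simp add: hyperbolic_def)
  obtain i0 :: nat where i0: "g \<otimes> y = y \<otimes> g \<otimes> z [^] i0"
    using commutator[of g y] g by auto
  obtain j0 :: nat where j0: "x \<otimes> g = g \<otimes> x \<otimes> z [^] j0"
    using commutator[of x g] g by auto
  define i where "i = i0 mod p"
  define j where "j = j0 mod p"
  have i: "g \<otimes> y = y \<otimes> g \<otimes> z [^] i" and j: "x \<otimes> g = g \<otimes> x \<otimes> z [^] j"
    using i0 j0 by (simp_all add: i_def j_def pow_mod)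
  \<comment> \<open>As \<open>p\<close> is an exponent of the group, \<open>w [^] (r * k)\<close> is
    the inverse of \<open>w [^] k\<close>; so \<open>a\<close> and \<open>b\<close> are the inverses
    of \<open>x^i\<close> and \<open>y^j\<close>, with natural exponents throughout.\<close>
  define r where "r = p - 1"
  define a where "a = x [^] (r * i)"
  define b where "b = y [^] (r * j)"
  have cl [simp]: "a \<in> carrier G" "b \<in> carrier G" by (simp_all add: a_def b_def)
  have e: "r * k + k = p * k" for k
    using p0 unfolding r_def by (metis Suc_diff_1 add.commute mult_Suc)
  have zp: "z [^] (p * k) = \<one>" for k :: nat
    by (metis exponent nat_pow_one nat_pow_pow z_closed)
  have ay: "a \<otimes> y = y \<otimes> a \<otimes> z [^] (r * i)"
    using commutator_pow_left[OF _ _ xy1] by (simp add: a_def)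
  have xb: "x \<otimes> b = b \<otimes> x \<otimes> z [^] (r * j)"
    using commutator_pow_right[OF _ _ xy1] by (simp add: b_def)
  have ax: "x \<otimes> a = a \<otimes> x \<otimes> z [^] (0::nat)" and bY: "b \<otimes> y = y \<otimes> b \<otimes> z [^] (0::nat)"
    by (simp_all add: a_def b_def pow_commutes)
  define c where "c = a \<otimes> (b \<otimes> g)"
  have "c \<otimes> y = y \<otimes> c \<otimes> z [^] (r * i + (0 + i))"
    unfolding c_def by (intro commutator_mult_left ay bY i) (simp_all add: g)
  moreover have "x \<otimes> c = c \<otimes> x \<otimes> z [^] (0 + (r * j + j))"
    unfolding c_def by (intro commutator_mult_right ax xb j) (simp_all add: g)
  ultimately have c: "c \<in> pair_centralizer x y"
    using g by (simp add: pair_centralizer_def c_def e zp)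
  have pw: "w [^] k \<otimes> w [^] (r * k) = \<one>" if "w \<in> carrier G" for w and k :: nat
  proof -
    have "w [^] k \<otimes> w [^] (r * k) = w [^] (p * k)"
      using that e[of k] by (simp add: nat_pow_mult add.commute)
    also have "\<dots> = (w [^] p) [^] k"
      using that by (simp add: nat_pow_pow)
    finally show ?thesis
      using that by (simp add: exponent)
  qed
  have "y [^] j \<otimes> x [^] i \<otimes> c = y [^] j \<otimes> (x [^] i \<otimes> a) \<otimes> b \<otimes> g"
    unfolding c_def using g by (simp add: m_assoc)
  also have "\<dots> = g"
    using g by (simp add: a_def b_def pw)
  finally show thesis
    using that[of i j c] c p0 by (simp add: i_def j_def)
qed

text \<open>Swapping with \<open>x\<close> sees only the factor \<open>y^j\<close> and yields
  \<open>z^j\<close>; swapping with \<open>y\<close> sees only \<open>x^i\<close> and yields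
  \<open>z^i\<close>. Hence the element determines both exponents modulo \<open>p\<close>. They are
  left unbounded because products of normal forms produce unreduced exponents.\<close>

lemma normal_form_unique:
  assumes c: "c \<in> pair_centralizer x y" and d: "d \<in> pair_centralizer x y"
    and eq: "y [^] (j::nat) \<otimes> x [^] (i::nat) \<otimes> c = y [^] (l::nat) \<otimes> x [^] (k::nat) \<otimes> d"
  shows "i mod p = k mod p \<and> j mod p = l mod p \<and> c = d"
proof -
  have xy1: "x \<otimes> y = y \<otimes> x \<otimes> z [^] (1::nat)"
    using xy by (simp add: hyperbolic_def)
  have cG: "c \<in> carrier G" and dG: "d \<in> carrier G"
    using c d pair_centralizer_closed by auto
  \<comment> \<open>The unsimplified exponents, here and in \<open>right\<close>, are those that the
    product rules assemble factor by factor.\<close>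
  have left: "x \<otimes> (y [^] j \<otimes> x [^] i \<otimes> c) = (y [^] j \<otimes> x [^] i \<otimes> c) \<otimes> x \<otimes> z [^] (1 * j + 0 + 0)"
    if "c \<in> pair_centralizer x y" for j i :: nat and c
    using that by (intro commutator_mult_right commutator_pow_right xy1)
      (auto simp: pair_centralizer_def pow_commutes)
  have right: "(y [^] j \<otimes> x [^] i \<otimes> c) \<otimes> y = y \<otimes> (y [^] j \<otimes> x [^] i \<otimes> c) \<otimes> z [^] (0 + 1 * i + 0)"
    if "c \<in> pair_centralizer x y" for j i :: nat and c
    using that by (intro commutator_mult_left commutator_pow_left xy1)
      (auto simp: pair_centralizer_def pow_commutes)
  have "z [^] j = z [^] l"
    using left[OF c, of j i] left[OF d, of l k] cG dG eq by simp
  moreover have "z [^] i = z [^] k"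
    using right[OF c, of j i] right[OF d, of l k] cG dG eq by simp
  ultimately have ij: "i mod p = k mod p" "j mod p = l mod p"
    by (simp_all add: z_pow_eq_iff)
  then have "x [^] i = x [^] k" "y [^] j = y [^] l"
    by (auto intro: pow_cong)
  with eq cG dG have "c = d" by simp
  with ij show ?thesis by simp
qed

text \<open>Moving \<open>x^i\<close> past \<open>y^l\<close> is the only swap that costs anything,
  namely \<open>z^(i l)\<close>. The formula mentions nothing special to the group except the
  product in the centralizer, which is what an isomorphism of centralizers controls.\<close>

lemma normal_form_mult:
  assumes c: "c \<in> pair_centralizer x y" and d: "d \<in> pair_centralizer x y"
  shows "(y [^] (j::nat) \<otimes> x [^] (i::nat) \<otimes> c) \<otimes> (y [^] (l::nat) \<otimes> x [^] (k::nat) \<otimes> d) =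
    y [^] (j + l) \<otimes> x [^] (i + k) \<otimes> (z [^] (i * l) \<otimes> (c \<otimes> d))"
proof -
  have xy1: "x \<otimes> y = y \<otimes> x \<otimes> z [^] (1::nat)"
    using xy by (simp add: hyperbolic_def)
  have cG: "c \<in> carrier G" and dG: "d \<in> carrier G"
    using c d pair_centralizer_closed by auto
  have cy: "c \<otimes> y [^] l = y [^] l \<otimes> c" and cx: "c \<otimes> x [^] k = x [^] k \<otimes> c"
    using commutator_pow_right[of c y 0 l] commutator_pow_right[of c x 0 k] c cG
    by (auto simp: pair_centralizer_def)
  have "x [^] i \<otimes> y = y \<otimes> x [^] i \<otimes> z [^] (1 * i)"
    by (intro commutator_pow_left xy1) auto
  then have xiy: "x [^] i \<otimes> y [^] l = y [^] l \<otimes> x [^] i \<otimes> z [^] (i * l)"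
    using commutator_pow_right[of "x [^] i" y "1 * i" l] by simp
  have "(y [^] j \<otimes> x [^] i \<otimes> c) \<otimes> (y [^] l \<otimes> x [^] k \<otimes> d)
      = y [^] j \<otimes> x [^] i \<otimes> (c \<otimes> y [^] l) \<otimes> x [^] k \<otimes> d"
    using cG dG by (simp add: m_assoc)
  also have "\<dots> = y [^] j \<otimes> (x [^] i \<otimes> y [^] l) \<otimes> (c \<otimes> x [^] k) \<otimes> d"
    using cG dG by (simp add: cy m_assoc)
  also have "\<dots> = y [^] j \<otimes> y [^] l \<otimes> x [^] i \<otimes> (z [^] (i * l) \<otimes> x [^] k) \<otimes> c \<otimes> d"
    using cG dG by (simp add: xiy cx m_assoc)
  also have "\<dots> = (y [^] j \<otimes> y [^] l) \<otimes> (x [^] i \<otimes> x [^] k) \<otimes> (z [^] (i * l) \<otimes> (c \<otimes> d))"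
    using cG dG by (simp add: zpow_central m_assoc)
  finally show ?thesis by (simp add: nat_pow_mult)
qed

lemma card_carrier: "card (carrier G) = p\<^sup>2 * card (pair_centralizer x y)"
proof -
  have "bij_betw (\<lambda>(i, j, c). y [^] j \<otimes> x [^] i \<otimes> c) ({..<p} \<times> {..<p} \<times> pair_centralizer x y) (carrier G)"
    (is "bij_betw ?f ?A _")
    unfolding bij_betw_def
  proof
    show "inj_on ?f ?A"
    proof (rule inj_onI)
      fix u v assume u: "u \<in> ?A" and v: "v \<in> ?A" and eq: "?f u = ?f v"
      obtain i j c where [simp]: "u = (i, j, c)" by (cases u)
      obtain k l d where [simp]: "v = (k, l, d)" by (cases v)
      show "u = v"
        using normal_form_unique[of c d j i l k] u v eq by simp
    qed
    show "?f ` ?A = carrier G"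
    proof
      show "?f ` ?A \<subseteq> carrier G"
        using pair_centralizer_closed by auto
      show "carrier G \<subseteq> ?f ` ?A"
      proof
        fix g assume "g \<in> carrier G"
        then obtain i j c where "i < p" "j < p" "c \<in> pair_centralizer x y"
            "g = y [^] (j::nat) \<otimes> x [^] (i::nat) \<otimes> c"
          by (rule normal_form_exists)
        then show "g \<in> ?f ` ?A"
          by (intro image_eqI[of _ _ "(i, j, c)"]) simp_all
      qed
    qed
  qed
  from bij_betw_same_card[OF this] show ?thesis
    by (simp add: card_cartesian_product power2_eq_square)
qed

text \<open>The condition to check is the last one: an element central in the centralizer commutes
  with \<open>x\<close>, \<open>y\<close> and every \<open>d\<close> in the centralizer, hence by
  the normal form with all of \<open>G\<close>, so it is already a power of
  \<open>z\<close>.\<close>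

lemma special_pair_centralizer: "special_p_group (G\<lparr>carrier := pair_centralizer x y\<rparr>) p z"
proof -
  let ?C = "pair_centralizer x y"
  have sub: "subgroup ?C G"
    by (rule subgroup_pair_centralizer) auto
  interpret C: group "G\<lparr>carrier := ?C\<rparr>"
    using subgroup_imp_group[OF sub] .
  have CG: "c \<in> carrier G" if "c \<in> ?C" for c
    using that pair_centralizer_closed by blast
  have pow: "a [^]\<^bsub>G\<lparr>carrier := ?C\<rparr>\<^esub> k = a [^] k" for a and k :: nat
    by (simp add: nat_pow_def)
  show ?thesis
  proof
    show "Factorial_Ring.prime p" by (rule prime)
    show "finite (carrier (G\<lparr>carrier := ?C\<rparr>))"
      using finite_carrier by (simp add: pair_centralizer_def)
    show "z \<in> carrier (G\<lparr>carrier := ?C\<rparr>)"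
      using z_in_pair_centralizer[of 1] by simp
    show "z \<noteq> \<one>\<^bsub>G\<lparr>carrier := ?C\<rparr>\<^esub>"
      using z_nontrivial by simp
  next
    fix a assume "a \<in> carrier (G\<lparr>carrier := ?C\<rparr>)"
    then have a: "a \<in> carrier G" using CG by simp
    show "a [^]\<^bsub>G\<lparr>carrier := ?C\<rparr>\<^esub> p = \<one>\<^bsub>G\<lparr>carrier := ?C\<rparr>\<^esub>"
      using exponent[OF a] by (simp add: pow)
    show "z \<otimes>\<^bsub>G\<lparr>carrier := ?C\<rparr>\<^esub> a = a \<otimes>\<^bsub>G\<lparr>carrier := ?C\<rparr>\<^esub> z"
      using z_central[OF a] by simp
  next
    fix a b assume "a \<in> carrier (G\<lparr>carrier := ?C\<rparr>)" "b \<in> carrier (G\<lparr>carrier := ?C\<rparr>)"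
    then show "\<exists>i::nat. a \<otimes>\<^bsub>G\<lparr>carrier := ?C\<rparr>\<^esub> b =
      b \<otimes>\<^bsub>G\<lparr>carrier := ?C\<rparr>\<^esub> a \<otimes>\<^bsub>G\<lparr>carrier := ?C\<rparr>\<^esub> z [^]\<^bsub>G\<lparr>carrier := ?C\<rparr>\<^esub> i"
      using commutator[of a b] CG by (simp add: pow)
  next
    fix c assume c: "c \<in> carrier (G\<lparr>carrier := ?C\<rparr>)"
      and comm: "\<And>a. a \<in> carrier (G\<lparr>carrier := ?C\<rparr>) \<Longrightarrow>
        c \<otimes>\<^bsub>G\<lparr>carrier := ?C\<rparr>\<^esub> a = a \<otimes>\<^bsub>G\<lparr>carrier := ?C\<rparr>\<^esub> c"
    have cC: "c \<in> ?C" and cG: "c \<in> carrier G"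
      using c CG by auto
    have "c \<otimes> g = g \<otimes> c" if g: "g \<in> carrier G" for g
    proof -
      obtain i j :: nat and d where d: "d \<in> ?C" and gd: "g = y [^] j \<otimes> x [^] i \<otimes> d"
        using normal_form_exists[OF g] by blast
      have "c \<otimes> g = g \<otimes> c \<otimes> z [^] (0 * j + 0 * i + (0::nat))"
        unfolding gd using cC cG CG[OF d] comm[of d] d
        by (intro commutator_mult_right commutator_pow_right) (auto simp: pair_centralizer_def)
      then show ?thesis using g cG by simp
    qed
    then show "\<exists>i::nat. c = z [^]\<^bsub>G\<lparr>carrier := ?C\<rparr>\<^esub> i"
      using central[OF cG] by (simp add: pow)
  qed
qed

end

end

section \<open>Order and uniqueness, by induction through centralizers of hyperbolic pairs\<close>

lemma (in special_p_group) prime_pos: "p > 0"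
  using prime prime_gt_0_nat by blast

lemma (in special_p_group) card_z_powers: "card (range (\<lambda>i::nat. z [^] i)) = p"
proof -
  have "range (\<lambda>i::nat. z [^] i) = (\<lambda>i. z [^] i) ` {..<p}"
  proof
    show "range (\<lambda>i::nat. z [^] i) \<subseteq> (\<lambda>i. z [^] i) ` {..<p}"
    proof clarify
      fix i :: nat
      show "z [^] i \<in> (\<lambda>i. z [^] i) ` {..<p}"
        using prime_pos by (intro image_eqI[of _ _ "i mod p"]) (simp_all add: pow_mod)
    qed
  qed auto
  moreover have "inj_on (\<lambda>i::nat. z [^] i) {..<p}"
    by (auto simp: inj_on_def z_pow_eq_iff)
  ultimately show ?thesis
    by (simp add: card_image)
qed

lemma (in special_p_group) card_pair_centralizer_less:
  assumes "hyperbolic x y"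
  shows "card (pair_centralizer x y) < card (carrier G)"
proof -
  have "pair_centralizer x y \<noteq> {}"
    using z_in_pair_centralizer[OF assms] by blast
  moreover have "finite (pair_centralizer x y)"
    using finite_carrier by (simp add: pair_centralizer_def)
  ultimately have "card (pair_centralizer x y) > 0"
    by (simp add: card_gt_0_iff)
  moreover have "p\<^sup>2 > 1"
    using prime_gt_1_nat[OF prime] by (intro one_less_power) auto
  ultimately show ?thesis
    by (simp add: card_carrier[OF assms])
qed

text \<open>Each hyperbolic pair that is split off accounts for a factor \<open>p^2\<close>; the
  process ends with the powers of \<open>z\<close>, of which there are \<open>p\<close>.\<close>

lemma special_p_group_order:
  assumes "special_p_group G p z"
  shows "\<exists>n. card (carrier G) = p ^ (2 * n + 1)"
  using assms
proof (induction "card (carrier G)" arbitrary: G rule: less_induct)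
  case less
  interpret special_p_group G p z by fact
  show ?case
  proof (cases "carrier G = range (\<lambda>i::nat. z [^]\<^bsub>G\<^esub> i)")
    case True
    then have "card (carrier G) = p ^ (2 * 0 + 1)"
      using card_z_powers by simp
    then show ?thesis by blast
  next
    case False
    then obtain x y where xy: "hyperbolic x y"
      by (rule exists_hyperbolic)
    obtain n where "card (pair_centralizer x y) = p ^ (2 * n + 1)"
      using less.hyps[OF _ special_pair_centralizer[OF xy]] card_pair_centralizer_less[OF xy] by auto
    then have "card (carrier G) = p ^ (2 * Suc n + 1)"
      by (simp add: card_carrier[OF xy] power2_eq_square)
    then show ?thesis by blast
  qed
qed

text \<open>The isomorphism is read off the normal forms with respect to hyperbolic pairs of the two groups,
  and given by induction on their centralizers. Prescribing the image of \<open>z\<close> makes the induction work.\<close>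
lemma special_p_group_iso:
  assumes "special_p_group G p z" "special_p_group H p w" "card (carrier G) = card (carrier H)"
  shows "\<exists>f \<in> iso G H. f z = w"
  using assms
proof (induction "card (carrier G)" arbitrary: G H rule: less_induct)
  case less
  interpret G: special_p_group G p z by fact
  interpret H: special_p_group H p w by fact
  show ?case
  proof (cases "carrier G = range (\<lambda>i::nat. z [^]\<^bsub>G\<^esub> i)")
    case True
    have "range (\<lambda>i::nat. w [^]\<^bsub>H\<^esub> i) = carrier H"
      using less.prems(3) G.card_z_powers H.card_z_powers H.finite_carrier True
      by (intro card_subset_eq) auto
    \<comment> \<open>The chosen exponent is determined only modulo \<open>p\<close>, which is
      harmless because \<open>w\<close> has order \<open>p\<close> as well.\<close>
    define f where "f g = w [^]\<^bsub>H\<^esub> (SOME i::nat. g = z [^]\<^bsub>G\<^esub> i)" for g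
    have f: "f (z [^]\<^bsub>G\<^esub> i) = w [^]\<^bsub>H\<^esub> i" for i :: nat
    proof -
      have "z [^]\<^bsub>G\<^esub> i = z [^]\<^bsub>G\<^esub> (SOME j::nat. z [^]\<^bsub>G\<^esub> i = z [^]\<^bsub>G\<^esub> j)"
        by (rule someI) simp
      then show ?thesis
        unfolding f_def by (metis G.z_pow_eq_iff H.z_pow_eq_iff)
    qed
    have "f \<in> hom G H"
      unfolding hom_def using True by (auto simp: f G.nat_pow_mult H.nat_pow_mult)
    moreover have "f ` carrier G = carrier H"
      using True \<open>range (\<lambda>i::nat. w [^]\<^bsub>H\<^esub> i) = carrier H\<close> by (auto simp: f image_image)
    moreover have "inj_on f (carrier G)"
      using True by (auto simp: inj_on_def f G.z_pow_eq_iff H.z_pow_eq_iff)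
    ultimately have "f \<in> iso G H"
      by (simp add: iso_def bij_betw_def)
    moreover have "f z = w"
      using f[of 1] by simp
    ultimately show ?thesis by blast
  next
    case False
    then obtain x y where xy: "G.hyperbolic x y"
      by (rule G.exists_hyperbolic)
    have "carrier H \<noteq> range (\<lambda>i::nat. w [^]\<^bsub>H\<^esub> i)"
    proof
      assume "carrier H = range (\<lambda>i::nat. w [^]\<^bsub>H\<^esub> i)"
      then have "card (carrier G) = p"
        using H.card_z_powers less.prems(3) by simp
      then have "range (\<lambda>i::nat. z [^]\<^bsub>G\<^esub> i) = carrier G"
        using G.card_z_powers G.finite_carrier by (intro card_subset_eq) auto
      with False show False by simp
    qed
    then obtain x' y' where xy': "H.hyperbolic x' y'"
      by (rule H.exists_hyperbolic)
    let ?C = "G.pair_centralizer x y" and ?D = "H.pair_centralizer x' y'"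
    have "card ?C = card ?D"
      using less.prems(3) G.card_carrier[OF xy] H.card_carrier[OF xy'] G.prime_pos by simp
    then obtain f0 where f0: "f0 \<in> iso (G\<lparr>carrier := ?C\<rparr>) (H\<lparr>carrier := ?D\<rparr>)" and f0z: "f0 z = w"
      using less.hyps[OF _ G.special_pair_centralizer[OF xy] H.special_pair_centralizer[OF xy']]
        G.card_pair_centralizer_less[OF xy] by auto
    have f0_closed: "f0 c \<in> ?D" if "c \<in> ?C" for c
      using f0 that by (auto simp: iso_def hom_def)
    have f0_mult: "f0 (c \<otimes>\<^bsub>G\<^esub> d) = f0 c \<otimes>\<^bsub>H\<^esub> f0 d" if "c \<in> ?C" "d \<in> ?C" for c d
      using f0 that by (auto simp: iso_def hom_def)
    have f0_surj: "f0 ` ?C = ?D"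
      using f0 by (auto simp: iso_def bij_betw_def)
    have C: "subgroup ?C G"
      using G.hyperbolic_closed[OF xy] by (rule G.subgroup_pair_centralizer)
    interpret C: subgroup ?C G by (rule C)
    have zC: "z [^]\<^bsub>G\<^esub> (i::nat) \<in> ?C" for i
      by (rule G.z_in_pair_centralizer[OF xy])
    interpret f0: group_hom "G\<lparr>carrier := ?C\<rparr>" "H\<lparr>carrier := ?D\<rparr>" f0
      using f0 G.special_pair_centralizer[OF xy] H.special_pair_centralizer[OF xy']
      by (auto simp: group_hom_def group_hom_axioms_def iso_def special_p_group_def)
    \<comment> \<open>This is where the prescribed image of \<open>z\<close> is used: the factor
      \<open>z^(i l)\<close> in a product of normal forms has to go to the factor
      \<open>w^(i l)\<close>.\<close>
    have f0_zpow: "f0 (z [^]\<^bsub>G\<^esub> i) = w [^]\<^bsub>H\<^esub> i" for i :: nat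
      using f0.hom_nat_pow[of z i] zC[of 1] f0z by (simp add: nat_pow_def)
    note cl = G.hyperbolic_closed[OF xy] H.hyperbolic_closed[OF xy']
      G.pair_centralizer_closed[OF xy] H.pair_centralizer_closed[OF xy']
    define n where "n c i j = y [^]\<^bsub>G\<^esub> j \<otimes>\<^bsub>G\<^esub> x [^]\<^bsub>G\<^esub> i \<otimes>\<^bsub>G\<^esub> c" for i j :: nat and c
    define n' where "n' c i j = y' [^]\<^bsub>H\<^esub> j \<otimes>\<^bsub>H\<^esub> x' [^]\<^bsub>H\<^esub> i \<otimes>\<^bsub>H\<^esub> c" for i j :: nat and c
    \<comment> \<open>The exponents range over all naturals, so that a product with exponents
      \<open>i + k\<close> and \<open>j + l\<close> is covered without reduction. The value is
      independent of the chosen normal form, since the exponents are unique modulo \<open>p\<close>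
      and \<open>H\<close> has exponent \<open>p\<close>.\<close>
    define f where "f g = (SOME h. \<exists>c i j. c \<in> ?C \<and> g = n c i j \<and> h = n' (f0 c) i j)" for g
    have f: "f (n c i j) = n' (f0 c) i j" if c: "c \<in> ?C" for c i j
      unfolding f_def
    proof (rule some_equality)
      fix h assume "\<exists>d k l. d \<in> ?C \<and> n c i j = n d k l \<and> h = n' (f0 d) k l"
      then obtain d k l where d: "d \<in> ?C" and eq: "n c i j = n d k l" and h: "h = n' (f0 d) k l"
        by blast
      have "i mod p = k mod p \<and> j mod p = l mod p \<and> c = d"
        using G.normal_form_unique[OF xy c d] eq by (simp add: n_def)
      then show "h = n' (f0 c) i j"
        using H.pow_cong[OF cl(3), of i k] H.pow_cong[OF cl(4), of j l] by (simp add: h n'_def)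
    qed (use c in blast)
    have ex: "\<exists>c i j. c \<in> ?C \<and> g = n c i j" if "g \<in> carrier G" for g
      using G.normal_form_exists[OF xy that] by (metis n_def)
    have ex': "\<exists>c i j. c \<in> ?D \<and> h = n' c i j" if "h \<in> carrier H" for h
      using H.normal_form_exists[OF xy' that] by (metis n'_def)
    have n_closed: "n c i j \<in> carrier G" if "c \<in> ?C" for c i j
      using that cl by (simp add: n_def)
    have n'_closed: "n' c i j \<in> carrier H" if "c \<in> ?D" for c i j
      using that cl by (simp add: n'_def)
    have "f \<in> hom G H"
    proof (rule homI)
      fix g assume "g \<in> carrier G"
      then show "f g \<in> carrier H"
        using ex f n'_closed f0_closed by metis
    next
      fix g h assume "g \<in> carrier G" "h \<in> carrier G"
      then obtain c i j d k l where c: "c \<in> ?C" and g: "g = n c i j" and d: "d \<in> ?C" and h: "h = n d k l"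
        using ex by metis
      have "g \<otimes>\<^bsub>G\<^esub> h = n (z [^]\<^bsub>G\<^esub> (i * l) \<otimes>\<^bsub>G\<^esub> (c \<otimes>\<^bsub>G\<^esub> d)) (i + k) (j + l)"
        unfolding g h n_def by (rule G.normal_form_mult[OF xy c d])
      moreover have "f g \<otimes>\<^bsub>H\<^esub> f h = n' (w [^]\<^bsub>H\<^esub> (i * l) \<otimes>\<^bsub>H\<^esub> (f0 c \<otimes>\<^bsub>H\<^esub> f0 d)) (i + k) (j + l)"
        unfolding g h f[OF c] f[OF d] n'_def
        by (rule H.normal_form_mult[OF xy' f0_closed[OF c] f0_closed[OF d]])
      ultimately show "f (g \<otimes>\<^bsub>G\<^esub> h) = f g \<otimes>\<^bsub>H\<^esub> f h"
        using c d zC by (simp add: f f0_mult f0_zpow)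
    qed
    moreover have "f ` carrier G = carrier H"
    proof
      show "f ` carrier G \<subseteq> carrier H"
        using \<open>f \<in> hom G H\<close> by (auto simp: hom_def)
      show "carrier H \<subseteq> f ` carrier G"
      proof
        fix h assume "h \<in> carrier H"
        then obtain d i j where "d \<in> ?D" and h: "h = n' d i j"
          using ex' by metis
        then obtain c where c: "c \<in> ?C" and "d = f0 c"
          unfolding f0_surj[symmetric] by blast
        then have "h = f (n c i j)"
          by (simp add: f h)
        then show "h \<in> f ` carrier G"
          using n_closed[OF c] by blast
      qed
    qed
    moreover from this have "inj_on f (carrier G)"
      using less.prems(3) G.finite_carrier by (intro eq_card_imp_inj_on) simp_all
    ultimately have "f \<in> iso G H"
      by (simp add: iso_def bij_betw_def)
    moreover have "f z = w"
    proof -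
      have "n z 0 0 = z" "n' w 0 0 = w"
        by (simp_all add: n_def n'_def)
      then show ?thesis
        using f[of z 0 0] zC[of 1] f0z by simp
    qed
    ultimately show ?thesis by blast
  qed
qed

subsection \<open>Finite fields\<close>

lemma (in cring) binomial_expansion:
  assumes x: "x \<in> carrier R" and y: "y \<in> carrier R"
  shows "(x \<oplus> y) [^] n = (\<Oplus>k\<in>{..n}. add_pow R (n choose k) (x [^] k \<otimes> y [^] (n - k)))"
proof (induction n)
  case 0
  then show ?case by simp
next
  case (Suc n)
  let ?S = "\<Oplus>k\<in>{..n}. add_pow R (n choose k) (x [^] k \<otimes> y [^] (n - k))"
  let ?A = "\<Oplus>k\<in>{..n}. add_pow R (n choose k) (x [^] Suc k \<otimes> y [^] (n - k))"
  let ?B = "\<Oplus>k\<in>{..n}. add_pow R (n choose k) (x [^] k \<otimes> y [^] (Suc n - k))"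
  let ?C = "\<Oplus>k\<in>{..n}. add_pow R (n choose Suc k) (x [^] Suc k \<otimes> y [^] (n - k))"
  have S: "?S \<in> carrier R"
    using x y by (intro finsum_closed) auto
  have A: "x \<otimes> ?S = ?A"
    using x y
    by (subst finsum_rdistr)
      (auto intro!: finsum_cong' simp: add_pow_rdistr m_assoc m_comm m_lcomm)
  have B: "y \<otimes> ?S = ?B"
    using x y
    by (subst finsum_rdistr)
      (auto intro!: finsum_cong' simp: add_pow_rdistr Suc_diff_le m_assoc m_comm m_lcomm)
  \<comment> \<open>The added top term has coefficient \<open>n choose Suc n\<close>, which is 0. It
    is needed so that splitting off the term at 0 and shifting the index turns \<open>?B\<close>
    into \<open>?C\<close>, ready for Pascal's rule with \<open>?A\<close>.\<close>
  have "?B = (\<Oplus>k\<in>{..Suc n}. add_pow R (n choose k) (x [^] k \<otimes> y [^] (Suc n - k)))"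
    using x y by (subst finsum_Suc) (auto simp: binomial_eq_0)
  also have "\<dots> = ?C \<oplus> y [^] Suc n"
    using x y by (subst finsum_Suc2) auto
  finally have B': "?B = ?C \<oplus> y [^] Suc n" .
  have AC: "?A \<in> carrier R" "?C \<in> carrier R"
    using x y by (auto intro!: finsum_closed)
  have "?A \<oplus> ?C = (\<Oplus>k\<in>{..n}. add_pow R (Suc n choose Suc k) (x [^] Suc k \<otimes> y [^] (n - k)))"
    using x y
    by (subst finsum_addf[symmetric]) (auto intro!: finsum_cong' simp: add.nat_pow_mult)
  then have "?A \<oplus> ?C \<oplus> y [^] Suc n =
      (\<Oplus>k\<in>{..Suc n}. add_pow R (Suc n choose k) (x [^] k \<otimes> y [^] (Suc n - k)))"
    using x y by (subst finsum_Suc2) auto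
  moreover have "(x \<oplus> y) [^] Suc n = x \<otimes> ?S \<oplus> y \<otimes> ?S"
  proof -
    have "(x \<oplus> y) [^] Suc n = (x \<oplus> y) \<otimes> ?S"
      using S x y by (simp add: Suc m_comm)
    then show ?thesis
      using S x y by (simp add: l_distr)
  qed
  ultimately show ?case
    using A B B' AC y by (simp add: a_assoc)
qed

lemma (in cring) add_pow_char:
  assumes "add_pow R p \<one> = \<zero>" "x \<in> carrier R" "p dvd (m::nat)"
  shows "add_pow R m x = \<zero>"
proof -
  have "add_pow R p x = add_pow R p \<one> \<otimes> x"
    using assms(2) by (simp add: add_pow_ldistr)
  then have "add_pow R p x = \<zero>"
    using assms by simp
  moreover from assms(3) obtain k where "m = p * k" by blast
  ultimately show ?thesis
    using assms(2) by (metis add.nat_pow_pow add.nat_pow_one)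
qed

lemma (in cring) frobenius_add:
  fixes p :: nat
  assumes p: "Factorial_Ring.prime p" and char: "add_pow R p \<one> = \<zero>"
    and x: "x \<in> carrier R" and y: "y \<in> carrier R"
  shows "(x \<oplus> y) [^] p = x [^] p \<oplus> y [^] p"
proof -
  let ?f = "\<lambda>k. add_pow R (p choose k) (x [^] k \<otimes> y [^] (p - k))"
  \<comment> \<open>With \<open>p = Suc (Suc r)\<close> the interior indices, whose binomial
    coefficients are divisible by \<open>p\<close>, are exactly \<open>Suc k\<close> for
    \<open>k <= r\<close>.\<close>
  obtain q where q: "p = Suc q"
    using prime_gt_0_nat[OF p] gr0_implies_Suc by blast
  obtain r where r: "q = Suc r"
    using prime_gt_1_nat[OF p] q gr0_implies_Suc by auto
  have mid: "?f (Suc k) = \<zero>" if "k \<le> r" for k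
  proof -
    have "p dvd (p choose Suc k)"
      using that p q r by (intro dvd_choose_prime) auto
    then show ?thesis
      using add_pow_char[OF char] x y by simp
  qed
  have "(x \<oplus> y) [^] p = (\<Oplus>k\<in>{..Suc q}. ?f k)"
    using binomial_expansion[OF x y, of p] q by simp
  also have "\<dots> = ?f (Suc q) \<oplus> (\<Oplus>k\<in>{..q}. ?f k)"
    using x y by (subst finsum_Suc) auto
  also have "(\<Oplus>k\<in>{..q}. ?f k) = (\<Oplus>k\<in>{..r}. ?f (Suc k)) \<oplus> ?f 0"
    unfolding r using x y by (subst finsum_Suc2) auto
  also have "(\<Oplus>k\<in>{..r}. ?f (Suc k)) = (\<Oplus>k\<in>{..r}. \<zero>)"
    using mid by (intro finsum_cong') auto
  finally show ?thesis
    using x y q by simp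
qed

lemma (in cring) frobenius_power_add:
  fixes p :: nat
  assumes "Factorial_Ring.prime p" "add_pow R p \<one> = \<zero>" "x \<in> carrier R" "y \<in> carrier R"
  shows "(x \<oplus> y) [^] (p ^ n) = x [^] (p ^ n) \<oplus> y [^] (p ^ n)"
proof (induction n)
  case (Suc n)
  have "(x \<oplus> y) [^] (p ^ Suc n) = ((x \<oplus> y) [^] (p ^ n)) [^] p"
    using assms by (simp add: nat_pow_pow mult.commute)
  also have "\<dots> = (x [^] (p ^ n)) [^] p \<oplus> (y [^] (p ^ n)) [^] p"
    using assms by (simp add: Suc frobenius_add)
  finally show ?case
    using assms by (simp add: nat_pow_pow mult.commute)
qed (use assms in simp)

text \<open>The cofactor \<open>D\<close> is the sum of all \<open>U^i A^(n-i)\<close>, and its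
  \<open>n + 1\<close> terms have the same image once \<open>h U = h A\<close>. With
  \<open>U\<close> the variable, \<open>A\<close> a constant \<open>a\<close> and \<open>h\<close>
  evaluation at \<open>a\<close>, the value of \<open>D\<close> is the derivative of
  \<open>X^(n+1)\<close> at \<open>a\<close>; this replaces a formal derivative in the proof that
  roots are simple.\<close>

lemma (in ring_hom_cring) pow_diff_factor:
  assumes U: "U \<in> carrier R" and A: "A \<in> carrier R" and UA: "h U = h A"
  shows "\<exists>D \<in> carrier R. U [^] Suc n \<ominus> A [^] Suc n = (U \<ominus> A) \<otimes> D \<and>
    h D = add_pow S (Suc n) (h A [^]\<^bsub>S\<^esub> n)"
proof (induction n)
  case 0
  then show ?case
    using U A by (intro bexI[of _ \<one>]) auto
next
  case (Suc n)
  then obtain D where D: "D \<in> carrier R" "U [^] Suc n \<ominus> A [^] Suc n = (U \<ominus> A) \<otimes> D"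
    and hD: "h D = add_pow S (Suc n) (h A [^]\<^bsub>S\<^esub> n)" by blast
  let ?a = "A [^] Suc n" and ?x = "U [^] Suc n"
  have cl: "?a \<in> carrier R" "?x \<in> carrier R" using U A by auto
  have "U [^] Suc (Suc n) \<ominus> A [^] Suc (Suc n) = U \<otimes> ?x \<ominus> A \<otimes> ?a"
    using U A by (simp add: R.m_comm)
  also have "\<dots> = U \<otimes> (?x \<ominus> ?a) \<oplus> (U \<ominus> A) \<otimes> ?a"
    using U A cl by algebra
  also have "\<dots> = (U \<ominus> A) \<otimes> (U \<otimes> D \<oplus> ?a)"
    unfolding D(2) using U A D(1) cl by algebra
  finally have "U [^] Suc (Suc n) \<ominus> A [^] Suc (Suc n) = (U \<ominus> A) \<otimes> (U \<otimes> D \<oplus> ?a)" .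
  moreover have "h (U \<otimes> D \<oplus> ?a) = add_pow S (Suc (Suc n)) (h A [^]\<^bsub>S\<^esub> Suc n)"
    using U A D(1) by (simp add: UA hD S.add_pow_rdistr S.r_distr S.m_comm)
  ultimately show ?case
    using U A D(1) by blast
qed

text \<open>The fixed points are the roots of \<open>X^q - X\<close>, which splits into linear
  factors. Every root \<open>a\<close> is simple: dividing out \<open>X - a\<close> leaves a
  cofactor with value \<open>q a^(q-1) - 1 = -1\<close> at \<open>a\<close>, as \<open>p\<close>
  divides \<open>q\<close>. So there are as many roots as the degree.\<close>

lemma (in algebraically_closed) card_frobenius_fixed:
  fixes p :: nat
  assumes p: "Factorial_Ring.prime p" and char: "add_pow L p \<one> = \<zero>" and k: "k > 0"
  shows "finite {x \<in> carrier L. x [^] (p ^ k) = x}" "card {x \<in> carrier L. x [^] (p ^ k) = x} = p ^ k"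
proof -
  define q where "q = p ^ k"
  have q1: "q > 1"
    unfolding q_def using prime_gt_1_nat[OF p] k by (intro one_less_power) auto
  then obtain m where m: "q = Suc m" "m > 0"
    by (cases q) auto
  let ?U = "poly_ring L"
  interpret UP: domain ?U
    using univ_poly_is_domain[OF carrier_is_subring] .
  define P where "P = X [^]\<^bsub>?U\<^esub> q \<ominus>\<^bsub>?U\<^esub> X"
  note X = var_closed(1)[OF carrier_is_subring]
  have P_closed: "P \<in> carrier ?U"
    unfolding P_def using X by simp
  have degree_X: "degree X = 1"
    by (simp add: var_def)
  have degree_Xq: "degree (X [^]\<^bsub>?U\<^esub> q) = q"
    using polynomial_pow_degree[OF X, of q] degree_X by simp
  have degree_neg_X: "degree (\<ominus>\<^bsub>?U\<^esub> X) = 1"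
    using univ_poly_a_inv_degree[OF carrier_is_subring X] degree_X by simp
  have "degree P = max (degree (X [^]\<^bsub>?U\<^esub> q)) (degree (\<ominus>\<^bsub>?U\<^esub> X))"
    unfolding P_def a_minus_def univ_poly_add using X q1 degree_neg_X degree_Xq
    by (intro poly_add_degree_eq[OF carrier_is_subring]) (simp_all only: univ_poly_carrier UP.nat_pow_closed UP.a_inv_closed)
  then have degree_P: "degree P = q"
    using q1 degree_neg_X degree_Xq by simp
  then have P0: "P \<noteq> []"
    using q1 by auto
  have eval_P: "eval P x = x [^] q \<ominus> x" if x: "x \<in> carrier L" for x
  proof -
    interpret E: ring_hom_cring ?U L "\<lambda>f. eval f x"
      using eval_cring_hom[OF carrier_is_subring x] .
    show ?thesis
      unfolding P_def using X by (simp add: eval_var x)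
  qed
  have is_root_P: "is_root P x \<longleftrightarrow> x \<in> carrier L \<and> x [^] q = x" for x
    using P0 eval_P by (auto simp: is_root_def)
  have count_P: "count (roots P) a = 1" if a: "is_root P a" for a
  proof -
    have aL: "a \<in> carrier L" and aq: "a [^] q = a"
      using a is_root_P by auto
    interpret E: ring_hom_cring ?U L "\<lambda>f. eval f a"
      using eval_cring_hom[OF carrier_is_subring aL] .
    interpret C: ring_hom_ring L ?U poly_of_const
      using canonical_embedding_ring_hom[OF carrier_is_subring] by simp
    define A where "A = poly_of_const a"
    have A: "A \<in> carrier ?U"
      unfolding A_def using aL by simp
    have XA: "X \<ominus>\<^bsub>?U\<^esub> A = [\<one>, \<ominus> a]"
    proof -
      have "X \<ominus>\<^bsub>?U\<^esub> A = poly_add X (poly_of_const (\<ominus> a))"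
        unfolding A_def a_minus_def using aL by (simp add: univ_poly_add)
      also have "\<dots> = [\<one>, \<ominus> a]"
        using aL by (auto simp: poly_of_const_def var_def)
      finally show ?thesis .
    qed
    have eval_A: "eval A a = a"
      using aL by (auto simp: A_def poly_of_const_def)
    obtain D where D: "D \<in> carrier ?U" "X [^]\<^bsub>?U\<^esub> Suc m \<ominus>\<^bsub>?U\<^esub> A [^]\<^bsub>?U\<^esub> Suc m = (X \<ominus>\<^bsub>?U\<^esub> A) \<otimes>\<^bsub>?U\<^esub> D"
      and eD: "eval D a = add_pow L (Suc m) (eval A a [^] m)"
      using E.pow_diff_factor[OF X A, of m] eval_A eval_var[OF aL] by auto
    have "p dvd q"
      unfolding q_def using k by (simp add: dvd_power)
    then have "eval D a = \<zero>"
      unfolding eD m(1)[symmetric] using aL by (intro add_pow_char[OF char]) (auto simp: eval_A)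
    have Aq: "A [^]\<^bsub>?U\<^esub> q = A"
      unfolding A_def using C.hom_nat_pow[OF aL, of q] aq by simp
    \<comment> \<open>Since \<open>a^q = a\<close>, the polynomial equals
      \<open>(X^q - a^q) - (X - a)\<close>, so its cofactor at \<open>X - a\<close> is
      \<open>D - 1\<close>.\<close>
    define S where "S = D \<ominus>\<^bsub>?U\<^esub> \<one>\<^bsub>?U\<^esub>"
    have S: "S \<in> carrier ?U"
      unfolding S_def using D(1) by simp
    have "P = (X [^]\<^bsub>?U\<^esub> q \<ominus>\<^bsub>?U\<^esub> A [^]\<^bsub>?U\<^esub> q) \<ominus>\<^bsub>?U\<^esub> (X \<ominus>\<^bsub>?U\<^esub> A)"
      unfolding P_def Aq using X A UP.nat_pow_closed[OF X, of q] by algebra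
    also have "\<dots> = (X \<ominus>\<^bsub>?U\<^esub> A) \<otimes>\<^bsub>?U\<^esub> S"
    proof -
      have "B \<otimes>\<^bsub>?U\<^esub> D \<ominus>\<^bsub>?U\<^esub> B = B \<otimes>\<^bsub>?U\<^esub> S" if "B \<in> carrier ?U" for B
        unfolding S_def using that D(1) by (simp add: a_minus_def UP.r_distr UP.r_minus)
      then show ?thesis
        unfolding m(1) D(2) using X A by simp
    qed
    finally have P_S: "P = [\<one>, \<ominus> a] \<otimes>\<^bsub>?U\<^esub> S"
      unfolding XA .
    have "eval S a = \<ominus> \<one>"
      unfolding S_def using D(1) \<open>eval D a = \<zero>\<close> by (simp add: a_minus_def)
    then have "eval S a \<noteq> \<zero>"
      by simp
    then have "S \<noteq> []" and "\<not> is_root S a"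
      by (auto simp: is_root_def)
    then have "count (roots S) a = 0"
      using roots_mem_iff_is_root[OF S, of a] not_in_iff[of a "roots S"] by blast
    then show ?thesis
      unfolding P_S using poly_mult_degree_one_monic_imp_same_roots[OF aL S \<open>S \<noteq> []\<close>] by simp
  qed
  have set_roots: "set_mset (roots P) = {x \<in> carrier L. x [^] q = x}"
    using roots_mem_iff_is_root[OF P_closed] is_root_P by auto
  have "size (roots P) = q"
    using roots_over_carrier[OF P_closed] degree_P by (simp add: splitted_def)
  moreover have "size (roots P) = card (set_mset (roots P))"
    using count_P roots_mem_iff_is_root[OF P_closed]
    by (simp add: size_multiset_overloaded_eq)
  ultimately show "card {x \<in> carrier L. x [^] (p ^ k) = x} = p ^ k"
    using set_roots by (simp add: q_def)
  show "finite {x \<in> carrier L. x [^] (p ^ k) = x}"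
    using set_roots finite_set_mset[of "roots P"] by (simp add: q_def)
qed

lemma (in field) subfield_frobenius_fixed:
  fixes p :: nat
  assumes p: "Factorial_Ring.prime p" and char: "add_pow R p \<one> = \<zero>"
  shows "subfield {x \<in> carrier R. x [^] (p ^ k) = x} R"
proof (rule subfieldI')
  have q: "p ^ k > 0"
    using prime_gt_0_nat[OF p] by simp
  note add = frobenius_power_add[OF p char, of _ _ k]
  show "subring {x \<in> carrier R. x [^] (p ^ k) = x} R"
  proof (rule subringI)
    fix h assume h: "h \<in> {x \<in> carrier R. x [^] (p ^ k) = x}"
    \<comment> \<open>Additivity of the Frobenius power settles negatives without a case distinction
      on the parity of \<open>p\<close>.\<close>
    then have "h \<oplus> (\<ominus> h) [^] (p ^ k) = (h \<oplus> \<ominus> h) [^] (p ^ k)"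
      by (subst add) auto
    also have "\<dots> = \<zero>"
      using h q by (simp add: r_neg nat_pow_zero)
    finally show "\<ominus> h \<in> {x \<in> carrier R. x [^] (p ^ k) = x}"
      using h by (simp add: sum_zero_eq_neg a_comm)
  qed (auto simp: add nat_pow_distrib)
  fix x assume "x \<in> {x \<in> carrier R. x [^] (p ^ k) = x} - {\<zero>}"
  then have x: "x \<in> Units R" and xq: "x [^] (p ^ k) = x"
    by (auto simp: field_Units)
  have "x \<otimes> inv x [^] (p ^ k) = x [^] (p ^ k) \<otimes> inv x [^] (p ^ k)"
    by (simp add: xq)
  also have "\<dots> = (x \<otimes> inv x) [^] (p ^ k)"
    using x by (intro nat_pow_distrib[symmetric]) auto
  finally have "x \<otimes> inv x [^] (p ^ k) = \<one>"
    using x by simp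
  then have "inv x [^] (p ^ k) = inv x"
    using x Units_closed[OF x] by (intro comm_inv_char[symmetric]) simp_all
  then show "inv x \<in> {x \<in> carrier R. x [^] (p ^ k) = x}"
    using x by simp
qed

text \<open>The field consists of the fixed points of the \<open>k\<close>-th Frobenius power in an
  algebraic closure of the integers modulo \<open>p\<close>. The carrier type is that of the
  closure, named explicitly because an existential statement cannot hide a type.\<close>

lemma exists_finite_field:
  assumes p: "Factorial_Ring.prime p" and k: "k > 0"
  shows "\<exists>K :: ((int list \<times> nat) multiset \<Rightarrow> int) ring.
    field K \<and> finite (carrier K) \<and> card (carrier K) = p ^ k \<and> add_pow K p \<one>\<^bsub>K\<^esub> = \<zero>\<^bsub>K\<^esub>"
proof -
  interpret Z: residues_prime p "residue_ring (int p)"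
    using p by (simp add: residues_prime_def)
  define L where "L = Z.alg_closure"
  interpret L: algebraic_closure L "Z.indexed_const ` carrier (residue_ring (int p))"
    unfolding L_def by (rule Z.alg_closureE)
  interpret h: ring_hom_ring "residue_ring (int p)" L Z.indexed_const
    unfolding L_def using Z.alg_closureE(2) L.ring_axioms
    by (intro ring_hom_ringI2) (auto simp: L_def Z.ring_axioms)
  \<comment> \<open>The characteristic is computed in the prime field and carried into the closure
    by the embedding.\<close>
  have "add_pow (residue_ring (int p)) n \<one>\<^bsub>residue_ring (int p)\<^esub> = int n mod int p" for n :: nat
    by (induction n) (auto simp: Z.res_zero_eq Z.res_one_eq Z.res_add_eq mod_simps add.commute)
  then have "add_pow (residue_ring (int p)) p \<one>\<^bsub>residue_ring (int p)\<^esub> = \<zero>\<^bsub>residue_ring (int p)\<^esub>"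
    by (simp add: Z.res_zero_eq)
  moreover have "Z.indexed_const (add_pow (residue_ring (int p)) n \<one>\<^bsub>residue_ring (int p)\<^esub>) = add_pow L n \<one>\<^bsub>L\<^esub>"
    for n :: nat
    by (induction n) simp_all
  ultimately have char: "add_pow L p \<one>\<^bsub>L\<^esub> = \<zero>\<^bsub>L\<^esub>"
    by (metis h.hom_zero)
  let ?F = "{x \<in> carrier L. x [^]\<^bsub>L\<^esub> (p ^ k) = x}"
  let ?K = "L\<lparr>carrier := ?F\<rparr>"
  have "field ?K"
    using L.subfield_iff(2)[OF L.subfield_frobenius_fixed[OF p char]] .
  moreover have "finite (carrier ?K)" "card (carrier ?K) = p ^ k"
    using L.card_frobenius_fixed[OF p char k] by simp_all
  moreover have "add_pow ?K n \<one>\<^bsub>?K\<^esub> = add_pow L n \<one>\<^bsub>L\<^esub>" for n :: nat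
    by (simp add: add_pow_def nat_pow_def)
  ultimately show ?thesis
    using char by (intro exI[of _ ?K]) simp
qed

text \<open>Size forces \<open>d > n\<close>, say \<open>d = n + e\<close>. Modulo
  \<open>p^n + 1\<close> the power \<open>p^n\<close> is \<open>-1\<close>, so
  \<open>p^d - 1\<close> becomes \<open>-(p^e + 1)\<close>; thus \<open>p^n + 1\<close> divides
  \<open>p^e + 1\<close>, and size again forces \<open>e >= n\<close>.\<close>

lemma power_plus_one_dvd_power_minus_one:
  fixes p :: nat
  assumes p: "p > 1" and d: "0 < d" "d \<le> 2 * n" and dvd: "p ^ n + 1 dvd p ^ d - 1"
  shows "d = 2 * n"
proof -
  have pd: "p ^ d > 1"
    using p d by (intro one_less_power) auto
  have "d > n"
  proof (rule ccontr)
    assume "\<not> d > n"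
    then have "p ^ d \<le> p ^ n"
      using p by (intro power_increasing) auto
    moreover have "p ^ n + 1 \<le> p ^ d - 1"
      using dvd pd by (intro dvd_imp_le) auto
    ultimately show False by linarith
  qed
  then obtain e where e: "d = n + e" "0 < e" "e \<le> n"
    using d by (metis add_le_cancel_left less_imp_add_positive mult_2)
  have "(p ^ d - 1) + (p ^ e + 1) = p ^ e * (p ^ n + 1)"
    using pd by (simp add: e(1) power_add algebra_simps)
  then have "p ^ n + 1 dvd p ^ e + 1"
    using dvd by (metis dvd_add_right_iff dvd_triv_right)
  then have "p ^ n \<le> p ^ e"
    using dvd_imp_le[of "p ^ n + 1" "p ^ e + 1"] by simp
  then have "n \<le> e"
    using p by (simp add: power_increasing_iff)
  with e show ?thesis by simp
qed

text \<open>The value of the functional at \<open>x\<close> is the exponent of \<open>c\<close> in \<open>x\<close> modulo a subgroup maximal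
  among those avoiding \<open>c\<close>.\<close>
lemma (in comm_group) exists_functional:
  fixes p :: nat
  assumes p: "Factorial_Ring.prime p" and fin: "finite (carrier G)"
    and exponent: "\<And>x. x \<in> carrier G \<Longrightarrow> x [^] p = \<one>"
    and c: "c \<in> carrier G" "c \<noteq> \<one>"
  obtains T :: "'a \<Rightarrow> nat" where "T c \<noteq> 0" "\<And>x. x \<in> carrier G \<Longrightarrow> T x < p"
    "\<And>x y. \<lbrakk>x \<in> carrier G; y \<in> carrier G\<rbrakk> \<Longrightarrow> T (x \<otimes> y) = (T x + T y) mod p"
proof -
  define \<M> where "\<M> = {M. subgroup M G \<and> c \<notin> M}"
  have "finite \<M>"
    by (rule finite_subset[of _ "Pow (carrier G)"]) (use fin in \<open>auto simp: \<M>_def dest: subgroup.subset\<close>)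
  moreover have "{\<one>} \<in> \<M>"
    using c triv_subgroup by (simp add: \<M>_def)
  ultimately obtain M where "M \<in> \<M>" and max: "\<And>M'. M' \<in> \<M> \<Longrightarrow> M \<subseteq> M' \<Longrightarrow> M = M'"
    using finite_has_maximal[of \<M>] by blast
  then have M: "subgroup M G" and cM: "c \<notin> M"
    by (auto simp: \<M>_def)
  interpret M: subgroup M G by (rule M)
  have pow_mem: "m [^] (i::nat) \<in> M" if "m \<in> M" for m i
    using that by (induction i) auto
  have pow_mod: "x [^] (i mod p) = x [^] i" if "x \<in> carrier G" for x and i :: nat
    using that exponent by (intro pow_mod_exponent)
  have cop: "\<exists>l. [j * l = 1] (mod p)" if "\<not> p dvd j" for j
  proof -
    have "coprime j p"
      using that p prime_imp_coprime coprime_commute by blast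
    then show ?thesis
      using cong_solve_coprime_nat by auto
  qed
  have inverse: "x [^] (j * l) = x" if "[j * l = 1] (mod p)" "x \<in> carrier G" for x and j l :: nat
    using that pow_mod by (metis cong_def nat_pow_eone)
  \<comment> \<open>If \<open>x\<close> is outside \<open>M\<close>, maximality puts
    \<open>c\<close> into the subgroup \<open>M'\<close> generated by \<open>M\<close> and
    \<open>x\<close>, say \<open>c = m x^j\<close>. As \<open>c\<close> is not in \<open>M\<close>,
    \<open>p\<close> does not divide \<open>j\<close>, so inverting \<open>j\<close> modulo
    \<open>p\<close> expresses \<open>x\<close> through \<open>c\<close>.\<close>
  have decomp: "\<exists>m j. m \<in> M \<and> j < p \<and> x = m \<otimes> c [^] (j::nat)" if x: "x \<in> carrier G" for x
  proof (cases "x \<in> M")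
    case True
    then show ?thesis
      using p prime_gt_0_nat by (intro exI[of _ x] exI[of _ 0]) auto
  next
    case False
    define M' where "M' = {m \<otimes> x [^] (j::nat) |m j. m \<in> M}"
    have "subgroup M' G"
    proof (rule subgroupI)
      fix a assume "a \<in> M'"
      then obtain m and j :: nat where m: "m \<in> M" and a: "a = m \<otimes> x [^] j"
        by (auto simp: M'_def)
      have "j + (p - 1) * j = p * j"
        using prime_gt_0_nat[OF p] by (cases p) auto
      then have "x [^] j \<otimes> x [^] ((p - 1) * j) = x [^] (p * j)"
        using nat_pow_mult[OF x, of j "(p - 1) * j"] by (simp only:)
      also have "\<dots> = \<one>"
        using nat_pow_pow[OF x, of p j] exponent[OF x] by simp
      finally have "inv (x [^] j) = x [^] ((p - 1) * j)"
        using x by (intro comm_inv_char) auto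
      then have "inv a = inv m \<otimes> x [^] ((p - 1) * j)"
        using m x by (simp add: a inv_mult)
      then show "inv a \<in> M'"
        using m by (auto simp: M'_def)
    next
      fix a b assume "a \<in> M'" "b \<in> M'"
      then obtain m k and j i :: nat where "m \<in> M" "a = m \<otimes> x [^] j" "k \<in> M" "b = k \<otimes> x [^] i"
        by (auto simp: M'_def)
      then have "a \<otimes> b = (m \<otimes> k) \<otimes> x [^] (j + i)" "m \<otimes> k \<in> M"
        using x by (simp_all add: m_ac flip: nat_pow_mult)
      then show "a \<otimes> b \<in> M'"
        by (auto simp: M'_def)
    next
      show "M' \<noteq> {}"
        using M.one_closed unfolding M'_def by blast
    qed (use x in \<open>auto simp: M'_def\<close>)
    moreover have "x \<in> M'"
      using x by (auto simp: M'_def intro!: exI[of _ \<one>] exI[of _ 1])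
    moreover have "M \<subseteq> M'"
    proof
      fix m assume "m \<in> M"
      then show "m \<in> M'"
        by (auto simp: M'_def intro!: exI[of _ m] exI[of _ 0])
    qed
    ultimately have "c \<in> M'"
      using max[of M'] False by (auto simp: \<M>_def)
    then obtain m j where m: "m \<in> M" and cmj: "c = m \<otimes> x [^] (j::nat)"
      by (auto simp: M'_def)
    have "\<not> p dvd j"
    proof
      assume "p dvd j"
      then have "x [^] j = \<one>"
        using pow_mod[OF x, of j] by (simp add: mod_eq_0_iff_dvd)
      with cmj m cM show False by simp
    qed
    then obtain l where l: "[j * l = 1] (mod p)"
      using cop by blast
    have "c [^] l = m [^] l \<otimes> x"
      using m x by (simp add: cmj nat_pow_distrib nat_pow_pow inverse[OF l x])
    then have "x = inv (m [^] l) \<otimes> c [^] l"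
      using M.mem_carrier[OF m] x by (simp flip: m_assoc)
    then have "x = inv (m [^] l) \<otimes> c [^] (l mod p)"
      using pow_mod c by simp
    moreover have "inv (m [^] l) \<in> M"
      using m pow_mem by simp
    ultimately show ?thesis
      using prime_gt_0_nat[OF p] mod_less_divisor by blast
  qed
  \<comment> \<open>Otherwise a power of \<open>c^j\<close> would be \<open>c\<close> itself, which
    \<open>M\<close> avoids.\<close>
  have c_pow: "p dvd j" if "c [^] (j::nat) \<in> M" for j
  proof (rule ccontr)
    assume "\<not> p dvd j"
    then obtain l where l: "[j * l = 1] (mod p)"
      using cop by blast
    have "(c [^] j) [^] l \<in> M"
      using that by (rule pow_mem)
    then show False
      using cM c inverse[OF l c(1)] by (simp add: nat_pow_pow)
  qed
  \<comment> \<open>The order of the exponents is fixed so that their difference is a natural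
    number; the lemma is later used in both directions.\<close>
  have unique: "i mod p = j mod p" if "m \<in> M" "k \<in> M" "m \<otimes> c [^] i = k \<otimes> c [^] j" "i \<le> j" for m k and i j :: nat
  proof -
    have mk: "m \<in> carrier G" "k \<in> carrier G"
      using that(1,2) by simp_all
    have "m \<otimes> c [^] i = k \<otimes> (c [^] (j - i) \<otimes> c [^] i)"
      unfolding nat_pow_mult[OF c(1)] using that(3,4) by simp
    also have "\<dots> = (k \<otimes> c [^] (j - i)) \<otimes> c [^] i"
      using mk c by (simp add: m_assoc)
    finally have "m = k \<otimes> c [^] (j - i)"
      using mk c by simp
    then have "c [^] (j - i) = inv k \<otimes> m"
      using mk c by (simp flip: m_assoc)
    then have "c [^] (j - i) \<in> M"
      using that(1,2) by simp
    then show ?thesis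
      using c_pow that(4) by (metis mod_eq_dvd_iff_nat)
  qed
  define T where "T x = (SOME j. j < p \<and> (\<exists>m\<in>M. x = m \<otimes> c [^] (j::nat)))" for x
  have T: "T x < p \<and> (\<exists>m\<in>M. x = m \<otimes> c [^] T x)" if "x \<in> carrier G" for x
    unfolding T_def by (rule someI_ex) (use decomp[OF that] in blast)
  have T_eq: "T x = j mod p" if xG: "x \<in> carrier G" and m: "m \<in> M" and xm: "x = m \<otimes> c [^] j" for x m j
  proof -
    obtain k where k: "k \<in> M" "x = k \<otimes> c [^] T x" and lt: "T x < p"
      using T[OF xG] by blast
    then have "T x mod p = j mod p"
      using unique[OF k(1) m, of "T x" j] unique[OF m k(1), of j "T x"] k(2) xm
      by (cases "T x \<le> j") simp_all
    with lt show ?thesis by simp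
  qed
  show thesis
  proof
    have "T c = 1 mod p"
      using c by (intro T_eq[of _ \<one>]) auto
    then show "T c \<noteq> 0"
      using prime_gt_1_nat[OF p] by simp
    show "T x < p" if "x \<in> carrier G" for x
      using T[OF that] by simp
    show "T (x \<otimes> y) = (T x + T y) mod p" if xy: "x \<in> carrier G" "y \<in> carrier G" for x y
    proof -
      obtain m k where mk: "m \<in> M" "k \<in> M" and x: "x = m \<otimes> c [^] T x" and y: "y = k \<otimes> c [^] T y"
        using T xy by blast
      have "x \<otimes> y = (m \<otimes> c [^] T x) \<otimes> (k \<otimes> c [^] T y)"
        using x y by simp
      also have "\<dots> = (m \<otimes> k) \<otimes> (c [^] T x \<otimes> c [^] T y)"
        using mk c by (simp add: m_ac)
      finally have "x \<otimes> y = (m \<otimes> k) \<otimes> c [^] (T x + T y)"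
        using c by (simp add: nat_pow_mult)
      moreover have "m \<otimes> k \<in> M"
        using mk by simp
      ultimately show ?thesis
        using T_eq[of "x \<otimes> y" "m \<otimes> k" "T x + T y"] m_closed[OF xy] by blast
    qed
  qed
qed

subsection \<open>An irreducible isometry\<close>

text \<open>The multiplicative group is cyclic of order \<open>d * k\<close>; the
  \<open>k\<close>-th power of a generator has order \<open>d\<close>.\<close>

lemma (in field) exists_element_of_order:
  assumes fin: "finite (carrier R)" and card: "card (carrier R) = d * k + 1" and d: "d > 0"
  shows "\<exists>u \<in> carrier R. \<forall>i::nat. u [^] i = \<one> \<longleftrightarrow> d dvd i"
proof -
  interpret M: group "Multiplicative_Group.mult_of R"
    rewrites "([^]\<^bsub>Multiplicative_Group.mult_of R\<^esub>) = (([^]) :: _ \<Rightarrow> nat \<Rightarrow> _)" and "\<one>\<^bsub>Multiplicative_Group.mult_of R\<^esub> = \<one>"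
    by (rule field_mult_group) (simp_all add: fun_eq_iff nat_pow_def)
  obtain a where a: "a \<in> carrier (Multiplicative_Group.mult_of R)" and gen: "carrier (Multiplicative_Group.mult_of R) = {a [^] i |i::nat. i \<in> UNIV}"
    using finite_field_mult_group_has_gen[OF fin] by blast
  have order: "order (Multiplicative_Group.mult_of R) = d * k"
    using order_mult_of[OF fin] card by (simp add: order_def)
  then have dk: "d * k > 0"
    using M.order_gt_0_iff_finite finite_mult_of[OF fin] by simp
  \<comment> \<open>The powers of \<open>a\<close> exhaust the group, so its order is at most
    \<open>M.ord a\<close>; Lagrange gives the converse bound.\<close>
  have "carrier (Multiplicative_Group.mult_of R) = (\<lambda>i. a [^] i) ` {0 .. M.ord a - 1}"
    using gen M.ord_elems[OF finite_mult_of[OF fin] a] by auto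
  then have "order (Multiplicative_Group.mult_of R) \<le> card {0 .. M.ord a - 1}"
    unfolding order_def by (simp only: card_image_le finite_atLeastAtMost)
  moreover have "M.ord a dvd order (Multiplicative_Group.mult_of R)"
    by (rule M.ord_dvd_group_order[OF a])
  ultimately have ord: "M.ord a = d * k"
    using M.ord_ge_1[OF finite_mult_of[OF fin] a] order dk by (auto dest: dvd_imp_le)
  have "a [^] k \<in> carrier R"
    using a by simp
  moreover have "(a [^] k) [^] i = \<one> \<longleftrightarrow> d dvd i" for i :: nat
  proof -
    have "(a [^] k) [^] i = a [^] (k * i)"
      using a by (simp add: nat_pow_pow)
    also have "\<dots> = \<one> \<longleftrightarrow> k * d dvd k * i"
      using M.pow_eq_id[OF a] by (simp add: ord mult.commute)
    finally show ?thesis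
      using dk by simp
  qed
  ultimately show ?thesis by blast
qed

text \<open>With \<open>q = p^n\<close>, the field is a quadratic extension of the field of order
  \<open>q\<close>, and \<open>u\<close> generates the norm-one elements, the solutions of
  \<open>x^(q+1) = 1\<close>.\<close>

locale singer_field = field R for R (structure) +
  fixes p n :: nat and u
  assumes prime: "Factorial_Ring.prime p" and odd: "odd p" and n_pos: "n > 0"
    and finite_carrier: "finite (carrier R)"
    and card_carrier: "card (carrier R) = p ^ (2 * n)"
    and char: "add_pow R p \<one> = \<zero>"
    and u_closed [simp, intro]: "u \<in> carrier R"
    and u_pow_eq_one_iff: "\<And>i::nat. u [^] i = \<one> \<longleftrightarrow> p ^ n + 1 dvd i"
begin

definition conj where "conj x = x [^] (p ^ n)"

lemma p_gt_1: "p > 1"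
  using prime prime_gt_1_nat by blast

lemma q_gt_2: "p ^ n > 2"
proof -
  have "p > 2"
    using p_gt_1 odd by (cases "p = 2") auto
  also have "p ^ 1 \<le> p ^ n"
    using n_pos p_gt_1 by (intro power_increasing) auto
  finally show ?thesis by simp
qed

lemma conj_closed [simp, intro]: "x \<in> carrier R \<Longrightarrow> conj x \<in> carrier R"
  by (simp add: conj_def)

lemma conj_add: "\<lbrakk>x \<in> carrier R; y \<in> carrier R\<rbrakk> \<Longrightarrow> conj (x \<oplus> y) = conj x \<oplus> conj y"
  unfolding conj_def by (rule frobenius_power_add[OF prime char])

lemma conj_mult: "\<lbrakk>x \<in> carrier R; y \<in> carrier R\<rbrakk> \<Longrightarrow> conj (x \<otimes> y) = conj x \<otimes> conj y"
  unfolding conj_def by (rule nat_pow_distrib)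

lemma conj_one [simp]: "conj \<one> = \<one>"
  by (simp add: conj_def)

lemma u_conj: "u \<otimes> conj u = \<one>"
  using u_pow_eq_one_iff[of "p ^ n + 1"] by (simp add: conj_def m_comm)

lemma u_nonzero: "u \<noteq> \<zero>"
  using u_conj by auto

lemma u_not_one: "u \<noteq> \<one>"
proof
  assume "u = \<one>"
  then have "p ^ n + 1 dvd 1"
    using u_pow_eq_one_iff[of 1] by simp
  then show False using p_gt_1 by simp
qed

text \<open>Otherwise \<open>u^2 = u * conj u = 1\<close>, against the order
  \<open>q + 1 > 2\<close>. The point is that \<open>form u \<one>\<close>, which is
  \<open>u - conj u\<close>, does not vanish.\<close>

lemma conj_u_ne: "conj u \<noteq> u"
proof
  assume "conj u = u"
  then have "u [^] (2::nat) = \<one>"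
    using u_conj by (simp add: numeral_2_eq_2)
  then have "p ^ n + 1 dvd 2"
    by (simp only: u_pow_eq_one_iff)
  then show False
    using q_gt_2 dvd_imp_le[of "p ^ n + 1" 2] by simp
qed

text \<open>The multipliers of \<open>U\<close> form a subring of order \<open>p ^ d\<close> whose nonzero elements are a
  group containing \<open>u\<close>; hence \<open>p ^ n + 1\<close> divides \<open>p ^ d - 1\<close>, so every element is a multiplier.\<close>
lemma irreducible:
  assumes U: "subgroup U (add_monoid R)" and u_inv: "\<And>x. x \<in> U \<Longrightarrow> u \<otimes> x \<in> U"
  shows "U = {\<zero>} \<or> U = carrier R"
proof (cases "U = {\<zero>}")
  case False
  interpret U: subgroup U "add_monoid R" by (rule U)
  have UR: "x \<in> carrier R" if "x \<in> U" for x
    using U.mem_carrier[OF that] by simp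
  have U_add: "x \<oplus> y \<in> U" if "x \<in> U" "y \<in> U" for x y
    using U.m_closed[OF that] by simp
  have U_neg: "\<ominus> x \<in> U" if "x \<in> U" for x
    using U.m_inv_closed[OF that] by (simp add: a_inv_def)
  have U_zero: "\<zero> \<in> U"
    using U.one_closed by simp
  define S where "S = {s \<in> carrier R. \<forall>x\<in>U. s \<otimes> x \<in> U}"
  have S: "s \<in> carrier R" "\<And>x. x \<in> U \<Longrightarrow> s \<otimes> x \<in> U" if "s \<in> S" for s
    using that by (auto simp: S_def)
  have uS: "u \<in> S" and oneS: "\<one> \<in> S" and zeroS: "\<zero> \<in> S"
    using u_inv UR U_zero by (auto simp: S_def)
  have S_mult: "s \<otimes> t \<in> S" if "s \<in> S" "t \<in> S" for s t
    using that UR by (auto simp: S_def m_assoc)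
  have finS: "finite S"
    using finite_carrier by (simp add: S_def)
  have "subgroup S (add_monoid R)"
  proof (rule add.subgroupI)
    fix s t assume "s \<in> S" "t \<in> S"
    then show "s \<oplus> t \<in> S"
      using UR U_add by (auto simp: S_def l_distr)
  next
    fix s assume "s \<in> S"
    then show "\<ominus> s \<in> S"
      using UR U_neg by (auto simp: S_def l_minus)
  qed (use zeroS in \<open>auto simp: S_def\<close>)
  then have "card S dvd p ^ (2 * n)"
    using add.lagrange[of S] card_carrier by (simp add: order_def) (metis dvd_triv_right)
  then obtain d where d: "d \<le> 2 * n" "card S = p ^ d"
    using divides_primepow_nat[OF prime] by blast
  interpret M: group "Multiplicative_Group.mult_of R"
    rewrites "([^]\<^bsub>Multiplicative_Group.mult_of R\<^esub>) = (([^]) :: _ \<Rightarrow> nat \<Rightarrow> _)" and "\<one>\<^bsub>Multiplicative_Group.mult_of R\<^esub> = \<one>"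
      and "(\<otimes>\<^bsub>Multiplicative_Group.mult_of R\<^esub>) = (\<otimes>)"
    by (rule field_mult_group) (simp_all add: fun_eq_iff nat_pow_def)
  have S_pow: "s [^] (i::nat) \<in> S" if "s \<in> S" for s i
    using that oneS S_mult by (induction i) auto
  have sub: "subgroup (S - {\<zero>}) (Multiplicative_Group.mult_of R)"
  proof (rule M.subgroupI)
    fix s assume s: "s \<in> S - {\<zero>}"
    then have sM: "s \<in> carrier (Multiplicative_Group.mult_of R)"
      using S by auto
    \<comment> \<open>In a finite group inverses are powers, so closure of \<open>S\<close> under
      multiplication gives closure under inverses.\<close>
    have "order (Multiplicative_Group.mult_of R) > 0"
      using M.order_gt_0_iff_finite finite_mult_of[OF finite_carrier] by simp
    then obtain m where m: "order (Multiplicative_Group.mult_of R) = Suc m"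
      using gr0_implies_Suc by blast
    have "s [^] m \<otimes> s = \<one>"
      using M.pow_order_eq_1[OF sM] by (simp add: m)
    then have "inv\<^bsub>Multiplicative_Group.mult_of R\<^esub> s = s [^] m"
      using M.inv_equality[of "s [^] m" s] sM M.nat_pow_closed[OF sM] by simp
    then show "inv\<^bsub>Multiplicative_Group.mult_of R\<^esub> s \<in> S - {\<zero>}"
      using S_pow s M.nat_pow_closed[OF sM, of m] by simp
  next
    fix s t assume "s \<in> S - {\<zero>}" "t \<in> S - {\<zero>}"
    then show "s \<otimes> t \<in> S - {\<zero>}"
      using S_mult S(1) by (simp add: integral_iff)
  qed (use S oneS in auto)
  interpret T: group "Multiplicative_Group.mult_of R\<lparr>carrier := S - {\<zero>}\<rparr>"
    using M.subgroup_imp_group[OF sub] .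
  \<comment> \<open>Lagrange inside the group of nonzero multipliers, which has
    \<open>p^d - 1\<close> elements: the order of \<open>u\<close> divides that number.\<close>
  have "u [^]\<^bsub>Multiplicative_Group.mult_of R\<lparr>carrier := S - {\<zero>}\<rparr>\<^esub> order (Multiplicative_Group.mult_of R\<lparr>carrier := S - {\<zero>}\<rparr>) = \<one>"
    using T.pow_order_eq_1[of u] uS u_nonzero by simp
  then have "u [^] (p ^ d - 1) = \<one>"
    using zeroS finS d(2) by (simp add: order_def nat_pow_def)
  then have dvd: "p ^ n + 1 dvd p ^ d - 1"
    by (simp only: u_pow_eq_one_iff)
  \<comment> \<open>Two distinct elements exclude \<open>d = 0\<close>, for which the divisibility
    would be vacuous.\<close>
  have "card {\<zero>, \<one>} \<le> card S"
    using finS zeroS oneS by (intro card_mono) auto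
  then have "d > 0"
    using d(2) by (cases d) auto
  then have "d = 2 * n"
    using power_plus_one_dvd_power_minus_one[OF p_gt_1 _ d(1) dvd] by simp
  then have S_all: "S = carrier R"
    using card_subset_eq[OF finite_carrier, of S] d(2) card_carrier by (auto simp: S_def)
  obtain a where a: "a \<in> U" "a \<noteq> \<zero>"
    using False U_zero by blast
  then have aU: "a \<in> Units R"
    using UR by (simp add: field_Units)
  have "y \<in> U" if y: "y \<in> carrier R" for y
  proof -
    have "(y \<otimes> inv a) \<otimes> a \<in> U"
      using S(2)[of "y \<otimes> inv a" a] S_all y aU a(1) by simp
    then show ?thesis
      using y aU by (simp add: m_assoc Units_closed)
  qed
  then show ?thesis
    using UR by blast
qed simp

text \<open>The hermitian form \<open>x * conj y\<close> minus its conjugate, the analogue of the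
  imaginary part of a hermitian form.\<close>

definition form where "form x y = x \<otimes> conj y \<ominus> conj x \<otimes> y"

lemma form_closed [simp, intro]: "\<lbrakk>x \<in> carrier R; y \<in> carrier R\<rbrakk> \<Longrightarrow> form x y \<in> carrier R"
  by (simp add: form_def)

lemma form_add_left:
  assumes "x \<in> carrier R" "x' \<in> carrier R" "y \<in> carrier R"
  shows "form (x \<oplus> x') y = form x y \<oplus> form x' y"
  using assms assms[THEN conj_closed]
  unfolding form_def conj_add[OF assms(1,2)] by algebra

lemma form_add_right:
  assumes "x \<in> carrier R" "y \<in> carrier R" "y' \<in> carrier R"
  shows "form x (y \<oplus> y') = form x y \<oplus> form x y'"
  using assms assms[THEN conj_closed]
  unfolding form_def conj_add[OF assms(2,3)] by algebra

lemma form_self: "x \<in> carrier R \<Longrightarrow> form x x = \<zero>"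
  by (simp add: form_def m_comm a_minus_def r_neg)

lemma form_anti:
  assumes "x \<in> carrier R" "y \<in> carrier R"
  shows "form x y \<oplus> form y x = \<zero>"
proof -
  have "form x y \<oplus> form y x = form x (x \<oplus> y) \<oplus> form y (x \<oplus> y)"
    using assms by (simp add: form_add_right form_self)
  also have "\<dots> = form (x \<oplus> y) (x \<oplus> y)"
    using assms by (intro form_add_left[symmetric]) auto
  also have "\<dots> = \<zero>"
    using assms by (intro form_self) auto
  finally show ?thesis .
qed

text \<open>Both terms are multiplied by the norm \<open>u * conj u = 1\<close>.\<close>

lemma form_u:
  assumes "x \<in> carrier R" "y \<in> carrier R"
  shows "form (u \<otimes> x) (u \<otimes> y) = form x y"
proof -
  have "form (u \<otimes> x) (u \<otimes> y) = (u \<otimes> conj u) \<otimes> (x \<otimes> conj y) \<ominus> (u \<otimes> conj u) \<otimes> (conj x \<otimes> y)"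
    using assms by (simp add: form_def conj_mult m_ac)
  then show ?thesis
    using assms by (simp add: u_conj form_def)
qed

text \<open>The field trace itself vanishes on every value of \<open>form\<close>, because
  conjugation changes the sign of such a value. The functional is therefore chosen to be nonzero at
  one value, \<open>form u \<one>\<close>; irreducibility turns this into nondegeneracy.\<close>

lemma exists_trace:
  obtains T :: "'a \<Rightarrow> nat" where "T (form u \<one>) \<noteq> 0" "\<And>x. x \<in> carrier R \<Longrightarrow> T x < p"
    "\<And>x y. \<lbrakk>x \<in> carrier R; y \<in> carrier R\<rbrakk> \<Longrightarrow> T (x \<oplus> y) = (T x + T y) mod p"
proof -
  have c: "form u \<one> \<noteq> \<zero>"
    using conj_u_ne by (auto simp: form_def)
  obtain T :: "'a \<Rightarrow> nat" where "T (form u \<one>) \<noteq> 0" "\<And>x. x \<in> carrier (add_monoid R) \<Longrightarrow> T x < p"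
    "\<And>x y. \<lbrakk>x \<in> carrier (add_monoid R); y \<in> carrier (add_monoid R)\<rbrakk>
      \<Longrightarrow> T (x \<otimes>\<^bsub>add_monoid R\<^esub> y) = (T x + T y) mod p"
  proof (rule comm_group.exists_functional[OF a_comm_group prime, of "form u \<one>"])
    show "x [^]\<^bsub>add_monoid R\<^esub> p = \<one>\<^bsub>add_monoid R\<^esub>" if "x \<in> carrier (add_monoid R)" for x
      using add_pow_char[OF char, of x p] that by (simp add: add_pow_def)
  qed (use c finite_carrier in auto)
  then show thesis
    using that by simp
qed

end

lemma exists_singer_field:
  assumes p: "Factorial_Ring.prime p" and "odd p" and n: "n > 0"
  shows "\<exists>(K :: ((int list \<times> nat) multiset \<Rightarrow> int) ring) u. singer_field K p n u"
proof -
  obtain K :: "((int list \<times> nat) multiset \<Rightarrow> int) ring" where K: "field K" and fin: "finite (carrier K)"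
    and card: "card (carrier K) = p ^ (2 * n)" and char: "add_pow K p \<one>\<^bsub>K\<^esub> = \<zero>\<^bsub>K\<^esub>"
    using exists_finite_field[OF p, of "2 * n"] n by auto
  interpret K: field K by (rule K)
  \<comment> \<open>Here \<open>r = q - 1\<close>, for the factorisation
    \<open>q^2 - 1 = (q + 1)(q - 1)\<close> of the order of the multiplicative group.\<close>
  obtain r where r: "p ^ n = Suc r"
    using prime_gt_0_nat[OF p] by (metis gr0_implies_Suc zero_less_power)
  have "p ^ (2 * n) = (p ^ n + 1) * r + 1"
    unfolding mult_2 power_add r by simp
  then obtain u where "u \<in> carrier K" "\<forall>i::nat. u [^]\<^bsub>K\<^esub> i = \<one>\<^bsub>K\<^esub> \<longleftrightarrow> p ^ n + 1 dvd i"
    using K.exists_element_of_order[OF fin, of "p ^ n + 1" r] card by auto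
  then have "singer_field K p n u"
    using assms fin card char K by (simp add: singer_field_def singer_field_axioms_def)
  then show ?thesis by blast
qed

subsection \<open>The Heisenberg group\<close>

locale singer_heisenberg = singer_field R p n u for R (structure) and p n u +
  fixes T :: "'a \<Rightarrow> nat"
  assumes T_form_u: "T (form u \<one>) \<noteq> 0"
    and T_less: "x \<in> carrier R \<Longrightarrow> T x < p"
    and T_add: "\<lbrakk>x \<in> carrier R; y \<in> carrier R\<rbrakk> \<Longrightarrow> T (x \<oplus> y) = (T x + T y) mod p"
begin

text \<open>A central extension of the additive group of the field by the integers modulo
  \<open>p\<close>, represented as naturals below \<open>p\<close>. Because the cocycle is
  alternating, powers are componentwise, which gives exponent \<open>p\<close>, and commutators are
  twice the cocycle.\<close>

definition H :: "('a \<times> nat) monoid" where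
  "H = \<lparr>carrier = carrier R \<times> {..<p},
    monoid.mult = \<lambda>(v, a) (w, b). (v \<oplus> w, (a + b + T (form v w)) mod p), one = (\<zero>, 0)\<rparr>"

lemma carrier_H: "carrier H = carrier R \<times> {..<p}"
  by (simp add: H_def)

lemma mult_H: "(v, a) \<otimes>\<^bsub>H\<^esub> (w, b) = (v \<oplus> w, (a + b + T (form v w)) mod p)"
  by (simp add: H_def)

lemma one_H: "\<one>\<^bsub>H\<^esub> = (\<zero>, 0)"
  by (simp add: H_def)

lemma p_pos: "p > 0"
  using p_gt_1 by simp

lemma T_zero: "T \<zero> = 0"
proof -
  have "(T \<zero> + T \<zero>) mod p = (T \<zero> + 0) mod p"
    using T_add[of \<zero> \<zero>] T_less[of \<zero>] by simp
  then have "[T \<zero> + T \<zero> = T \<zero> + 0] (mod p)"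
    by (simp only: cong_def)
  then have "[T \<zero> = 0] (mod p)"
    by (simp only: cong_add_lcancel_nat)
  then show ?thesis
    using T_less[of \<zero>] by (simp add: cong_def)
qed

lemma form_zero_left: "y \<in> carrier R \<Longrightarrow> form \<zero> y = \<zero>"
  using form_add_left[of \<zero> \<zero> y] by (metis add.l_cancel_one' form_closed l_zero zero_closed)

lemma form_zero_right: "y \<in> carrier R \<Longrightarrow> form y \<zero> = \<zero>"
  using form_anti[of y \<zero>] by (simp add: form_zero_left)

lemma form_neg_self:
  assumes "y \<in> carrier R"
  shows "form (\<ominus> y) y = \<zero>"
  using form_add_left[of "\<ominus> y" y y] assms by (simp add: l_neg form_self form_zero_left)

lemma T_form_anti:
  assumes "x \<in> carrier R" "y \<in> carrier R"
  shows "(T (form x y) + T (form y x)) mod p = 0"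
  using T_add[of "form x y" "form y x"] assms by (simp add: form_anti T_zero)

sublocale H: group H
proof (rule groupI)
  fix g h k assume "g \<in> carrier H" "h \<in> carrier H" "k \<in> carrier H"
  then obtain v a w b x c where g: "g = (v, a)" "h = (w, b)" "k = (x, c)"
    and cl: "v \<in> carrier R" "w \<in> carrier R" "x \<in> carrier R"
    by (auto simp: carrier_H)
  \<comment> \<open>The cocycle identity: by biadditivity both sides contain the same three values
    of \<open>T\<close>.\<close>
  have "(((a + b + T (form v w)) mod p) + c + (T (form v x) + T (form w x)) mod p) mod p
      = (a + ((b + c + T (form w x)) mod p) + (T (form v w) + T (form v x)) mod p) mod p"
    (is "?l = ?r")
  proof -
    have "?l = (a + b + T (form v w) + c + (T (form v x) + T (form w x))) mod p"
      by (rule mod_add_cong) (simp_all add: mod_add_left_eq)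
    also have "\<dots> = (a + (b + c + T (form w x)) + (T (form v w) + T (form v x))) mod p"
      by (simp add: ac_simps)
    also have "\<dots> = ?r"
      by (rule mod_add_cong) (simp_all add: mod_add_right_eq)
    finally show ?thesis .
  qed
  then show "g \<otimes>\<^bsub>H\<^esub> h \<otimes>\<^bsub>H\<^esub> k = g \<otimes>\<^bsub>H\<^esub> (h \<otimes>\<^bsub>H\<^esub> k)"
    using cl by (simp add: g mult_H form_add_left form_add_right T_add a_assoc)
next
  fix g assume "g \<in> carrier H"
  then obtain v a where g: "g = (v, a)" "v \<in> carrier R" "a < p"
    by (auto simp: carrier_H)
  then show "\<one>\<^bsub>H\<^esub> \<otimes>\<^bsub>H\<^esub> g = g"
    by (simp add: one_H mult_H form_zero_left T_zero)
  \<comment> \<open>The outer reduction matters only for \<open>a = 0\<close>, where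
    \<open>p - a\<close> is not below \<open>p\<close>.\<close>
  have "(\<ominus> v, (p - a) mod p) \<otimes>\<^bsub>H\<^esub> g = \<one>\<^bsub>H\<^esub>"
    using g by (simp add: one_H mult_H form_neg_self T_zero l_neg mod_simps)
  moreover have "(\<ominus> v, (p - a) mod p) \<in> carrier H"
    using g p_pos by (simp add: carrier_H)
  ultimately show "\<exists>h\<in>carrier H. h \<otimes>\<^bsub>H\<^esub> g = \<one>\<^bsub>H\<^esub>"
    by blast
qed (auto simp: carrier_H one_H mult_H p_pos)

lemma pow_H:
  assumes "v \<in> carrier R" "a < p"
  shows "(v, a) [^]\<^bsub>H\<^esub> (k::nat) = (add_pow R k v, (k * a) mod p)"
proof (induction k)
  case 0
  then show ?case by (simp add: one_H)
next
  case (Suc k)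
  have "form (add_pow R k v) v = \<zero>"
    using assms(1) by (induction k) (simp_all add: form_zero_left form_add_left form_self)
  then show ?case
    using Suc assms by (simp add: mult_H T_zero mod_simps add.commute)
qed

definition z where "z = (\<zero>, 1::nat)"

lemma pow_z: "z [^]\<^bsub>H\<^esub> (k::nat) = (\<zero>, k mod p)"
  using p_gt_1 pow_H[of \<zero> 1 k] by (simp add: z_def)

text \<open>The radical of the form is invariant under \<open>u\<close>, hence trivial.\<close>
lemma nondegenerate:
  assumes c: "c \<in> carrier R" and rad: "\<And>w. w \<in> carrier R \<Longrightarrow> T (form c w) = 0"
  shows "c = \<zero>"
proof -
  define U where "U = {c \<in> carrier R. \<forall>w\<in>carrier R. T (form c w) = 0}"
  have "subgroup U (add_monoid R)"
  proof (rule add.subgroupI)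
    show "U \<noteq> {}"
      using c rad by (auto simp: U_def)
    fix a b assume a: "a \<in> U" and "b \<in> U"
    then show "a \<oplus> b \<in> U"
      by (simp add: U_def form_add_left T_add)
    show "\<ominus> a \<in> U"
    proof -
      have "T (form (\<ominus> a) w) = 0" if w: "w \<in> carrier R" for w
      proof -
        have "T (form (\<ominus> a) w) = (T (form a w) + T (form (\<ominus> a) w)) mod p"
          using a w T_less by (simp add: U_def)
        also have "\<dots> = T (form (a \<oplus> \<ominus> a) w)"
          using a w by (simp add: U_def form_add_left T_add)
        also have "\<dots> = 0"
          using a w by (simp add: U_def r_neg form_zero_left T_zero)
        finally show ?thesis .
      qed
      then show ?thesis
        using a by (simp add: U_def)
    qed
  qed (auto simp: U_def)
  moreover have "u \<otimes> x \<in> U" if x: "x \<in> U" for x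
  proof -
    have "T (form (u \<otimes> x) w) = 0" if w: "w \<in> carrier R" for w
    proof -
      \<comment> \<open>Writing \<open>w\<close> as \<open>u\<close> times \<open>conj u * w\<close>
        lets the invariance of the form cancel \<open>u\<close> from both arguments.\<close>
      have "form (u \<otimes> x) w = form (u \<otimes> x) (u \<otimes> (conj u \<otimes> w))"
        using w u_conj by (simp flip: m_assoc)
      also have "\<dots> = form x (conj u \<otimes> w)"
        using x w by (intro form_u) (auto simp: U_def)
      finally show ?thesis
        using x w by (simp add: U_def)
    qed
    then show ?thesis
      using x by (simp add: U_def)
  qed
  ultimately have "U = {\<zero>} \<or> U = carrier R"
    by (rule irreducible)
  moreover have "u \<notin> U"
    using T_form_u by (auto simp: U_def)
  ultimately have "U = {\<zero>}"
    by auto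
  moreover have "c \<in> U"
    using c rad by (simp add: U_def)
  ultimately show ?thesis
    by simp
qed

lemma special_H: "special_p_group H p z"
proof
  show "Factorial_Ring.prime p" by (rule prime)
  show "finite (carrier H)"
    by (simp add: carrier_H finite_carrier)
  show "z \<in> carrier H"
    using p_gt_1 by (simp add: carrier_H z_def)
  show "z \<noteq> \<one>\<^bsub>H\<^esub>"
    by (simp add: one_H z_def)
next
  fix g assume "g \<in> carrier H"
  then obtain v a where g: "g = (v, a)" "v \<in> carrier R" "a < p"
    by (auto simp: carrier_H)
  show "g [^]\<^bsub>H\<^esub> p = \<one>\<^bsub>H\<^esub>"
    using add_pow_char[OF char, of v p] g by (simp add: pow_H one_H)
  show "z \<otimes>\<^bsub>H\<^esub> g = g \<otimes>\<^bsub>H\<^esub> z"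
    using g by (simp add: z_def mult_H form_zero_left form_zero_right)
next
  fix g h assume "g \<in> carrier H" "h \<in> carrier H"
  then obtain v a w b where g: "g = (v, a)" "h = (w, b)" "v \<in> carrier R" "w \<in> carrier R"
    by (auto simp: carrier_H)
  \<comment> \<open>A natural number congruent to \<open>T (form v w) - T (form w v)\<close> modulo
    \<open>p\<close>.\<close>
  define i where "i = T (form v w) + (p - 1) * T (form w v)"
  have "b + a + T (form w v) + i = a + b + T (form v w) + p * T (form w v)"
    unfolding i_def using p_pos by (cases p) auto
  then have "(b + a + T (form w v) + i) mod p = (a + b + T (form v w)) mod p"
    by (simp only: mod_mult_self2)
  then have "g \<otimes>\<^bsub>H\<^esub> h = h \<otimes>\<^bsub>H\<^esub> g \<otimes>\<^bsub>H\<^esub> z [^]\<^bsub>H\<^esub> i"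
    unfolding pow_z using g a_comm[of v w] by (simp add: mult_H form_zero_right T_zero mod_add_eq)
  then show "\<exists>i::nat. g \<otimes>\<^bsub>H\<^esub> h = h \<otimes>\<^bsub>H\<^esub> g \<otimes>\<^bsub>H\<^esub> z [^]\<^bsub>H\<^esub> i"
    by blast
next
  fix g assume "g \<in> carrier H" and comm: "\<And>h. h \<in> carrier H \<Longrightarrow> g \<otimes>\<^bsub>H\<^esub> h = h \<otimes>\<^bsub>H\<^esub> g"
  then obtain c a where g: "g = (c, a)" "c \<in> carrier R" "a < p"
    by (auto simp: carrier_H)
  have "T (form c w) = 0" if w: "w \<in> carrier R" for w
  proof -
    have "g \<otimes>\<^bsub>H\<^esub> (w, 0) = (w, 0) \<otimes>\<^bsub>H\<^esub> g"
      using w p_pos by (intro comm) (simp add: carrier_H)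
    then have "[a + T (form c w) = a + T (form w c)] (mod p)"
      by (simp add: g mult_H cong_def)
    then have "[T (form c w) = T (form w c)] (mod p)"
      by (simp only: cong_add_lcancel_nat)
    \<comment> \<open>The value is both symmetric, by commutation, and antisymmetric, so twice it
      vanishes; \<open>p\<close> being odd, it is zero.\<close>
    then have "[T (form c w) + T (form c w) = T (form c w) + T (form w c)] (mod p)"
      by (simp only: cong_add_lcancel_nat)
    then have "p dvd 2 * T (form c w)"
      using T_form_anti[OF g(2) w] by (simp add: cong_def mult_2 mod_eq_0_iff_dvd)
    moreover have "coprime p 2"
      using odd by simp
    ultimately have "p dvd T (form c w)"
      by (simp add: coprime_dvd_mult_right_iff)
    then show ?thesis
      using T_less[of "form c w"] g w by (auto dest: dvd_imp_le)
  qed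
  then have "c = \<zero>"
    using nondegenerate g by blast
  then have "g = z [^]\<^bsub>H\<^esub> a"
    using g by (simp add: pow_z)
  then show "\<exists>i::nat. g = z [^]\<^bsub>H\<^esub> i"
    by blast
qed

lemma card_H: "card (carrier H) = p ^ (2 * n + 1)"
  by (simp add: carrier_H card_cartesian_product card_carrier)

section \<open>The automorphism of the model and its invariant subgroups\<close>

definition \<phi> where "\<phi> = (\<lambda>x\<in>carrier H. (u \<otimes> fst x, snd x))"

lemma \<phi>_apply: "\<lbrakk>v \<in> carrier R; a < p\<rbrakk> \<Longrightarrow> \<phi> (v, a) = (u \<otimes> v, a)"
  by (simp add: \<phi>_def carrier_H)

lemma \<phi>_pow: "\<lbrakk>v \<in> carrier R; a < p\<rbrakk> \<Longrightarrow> (\<phi> ^^ k) (v, a) = (u [^] k \<otimes> v, a)"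
  by (induction k) (simp_all add: \<phi>_apply m_assoc m_lcomm)

lemma \<phi>_pow_order:
  assumes "x \<in> carrier H"
  shows "(\<phi> ^^ (p ^ n + 1)) x = x"
proof -
  obtain v a where x: "x = (v, a)" "v \<in> carrier R" "a < p"
    using assms by (auto simp: carrier_H)
  have "u [^] (p ^ n + 1) = \<one>"
    by (simp only: u_pow_eq_one_iff dvd_refl)
  then show ?thesis
    using \<phi>_pow[OF x(2,3), of "p ^ n + 1"] x by simp
qed

lemma \<phi>_auto: "\<phi> \<in> auto H"
proof -
  have "\<phi> \<in> hom H H"
    by (rule homI) (auto simp: \<phi>_apply carrier_H mult_H form_u r_distr p_pos)
  moreover have "inj_on \<phi> (carrier H)"
    by (auto simp: inj_on_def carrier_H \<phi>_apply u_nonzero m_lcancel)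
  moreover from this have "\<phi> ` carrier H = carrier H"
  proof (intro card_subset_eq)
    show "\<phi> ` carrier H \<subseteq> carrier H"
      using \<open>\<phi> \<in> hom H H\<close> by (auto simp: hom_def)
  qed (use finite_carrier in \<open>simp_all add: carrier_H card_image\<close>)
  ultimately show ?thesis
    by (simp add: auto_def Bij_def bij_betw_def \<phi>_def)
qed

lemma \<phi>_fixes_proper:
  assumes W: "subgroup W H" and inv: "\<phi> ` W = W" and proper: "W \<noteq> carrier H" and h: "h \<in> W"
  shows "\<phi> h = h"
proof -
  interpret W: subgroup W H by (rule W)
  have WH: "v \<in> carrier R \<and> a < p" if "(v, a) \<in> W" for v a
    using W.mem_carrier[OF that] by (simp add: carrier_H)
  define U where "U = fst ` W"
  have "subgroup U (add_monoid R)"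
  proof (rule add.subgroupI)
    show "U \<subseteq> carrier R"
      using WH by (auto simp: U_def)
    show "U \<noteq> {}"
      using W.one_closed unfolding U_def by blast
    fix v w assume "v \<in> U" and "w \<in> U"
    then obtain a b where va: "(v, a) \<in> W" and "(w, b) \<in> W"
      by (auto simp: U_def)
    then have "(v, a) \<otimes>\<^bsub>H\<^esub> (w, b) \<in> W"
      by (intro W.m_closed)
    then show "v \<oplus> w \<in> U"
      by (force simp: U_def mult_H)
    \<comment> \<open>Only the first component of the inverse is needed, and the product formula
      identifies it as the negative of \<open>v\<close>.\<close>
    obtain w' b' where inv: "inv\<^bsub>H\<^esub> (v, a) = (w', b')"
      by fastforce
    have "(w', b') \<in> W"
      using W.m_inv_closed[OF va] inv by simp
    moreover have "v \<oplus> w' = \<zero>"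
      using H.r_inv[OF W.mem_carrier[OF va]] by (simp add: inv mult_H one_H)
    ultimately have "\<ominus> v = w'"
      using WH va minus_equality[of w' v] a_comm[of v w'] by auto
    with \<open>(w', b') \<in> W\<close> show "\<ominus> v \<in> U"
      by (force simp: U_def)
  qed
  moreover have "u \<otimes> v \<in> U" if "v \<in> U" for v
  proof -
    obtain a where "(v, a) \<in> W"
      using \<open>v \<in> U\<close> by (auto simp: U_def)
    then have "(u \<otimes> v, a) \<in> W"
      using inv WH \<phi>_apply by (metis image_eqI)
    then show ?thesis
      by (force simp: U_def)
  qed
  ultimately have "U = {\<zero>} \<or> U = carrier R"
    by (rule irreducible)
  then show ?thesis
  proof
    assume U: "U = {\<zero>}"
    obtain v a where h': "h = (v, a)" by fastforce
    then have "v = \<zero>"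
      using h U by (force simp: U_def)
    then show ?thesis
      using h h' WH by (simp add: \<phi>_apply)
  next
    assume U: "U = carrier R"
    interpret S: special_p_group H p z by (rule special_H)
    have lift: "\<exists>a. (v, a) \<in> W" if "v \<in> carrier R" for v
    proof -
      have "v \<in> fst ` W"
        using U that by (simp add: U_def)
      then show ?thesis by auto
    qed
    \<comment> \<open>Lifts of \<open>u\<close> and 1 are chosen because \<open>T\<close> is known
      to be nonzero on the form at this pair, so their commutator is a nontrivial power of
      \<open>z\<close>.\<close>
    obtain a b where g: "(u, a) \<in> W" and h: "(\<one>, b) \<in> W"
      using lift[OF u_closed] lift[OF one_closed] by blast
    have gh: "(u, a) \<in> carrier H" "(\<one>, b) \<in> carrier H"
      using g h by (auto intro: W.mem_carrier)
    obtain i :: nat where i: "(u, a) \<otimes>\<^bsub>H\<^esub> (\<one>, b) = (\<one>, b) \<otimes>\<^bsub>H\<^esub> (u, a) \<otimes>\<^bsub>H\<^esub> z [^]\<^bsub>H\<^esub> i"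
      using S.commutator[OF gh] by blast
    have "z [^]\<^bsub>H\<^esub> i = inv\<^bsub>H\<^esub> ((\<one>, b) \<otimes>\<^bsub>H\<^esub> (u, a)) \<otimes>\<^bsub>H\<^esub> ((u, a) \<otimes>\<^bsub>H\<^esub> (\<one>, b))"
      using gh by (intro H.inv_solve_left[THEN iffD2] i) auto
    then have ziW: "(\<zero>, i mod p) \<in> W"
      using g h by (simp add: pow_z)
    have "\<not> p dvd i"
    proof
      assume "p dvd i"
      then have "z [^]\<^bsub>H\<^esub> i = \<one>\<^bsub>H\<^esub>"
        by (simp add: pow_z one_H)
      then have "(u, a) \<otimes>\<^bsub>H\<^esub> (\<one>, b) = (\<one>, b) \<otimes>\<^bsub>H\<^esub> (u, a)"
        using i gh by simp
      then have "[(a + b) + T (form u \<one>) = (a + b) + T (form \<one> u)] (mod p)"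
        by (simp add: mult_H cong_def add_ac)
      then have "[T (form u \<one>) = T (form \<one> u)] (mod p)"
        by (simp only: cong_add_lcancel_nat)
      then have "[T (form u \<one>) + T (form u \<one>) = T (form u \<one>) + T (form \<one> u)] (mod p)"
        by (simp only: cong_add_lcancel_nat)
      then have "p dvd 2 * T (form u \<one>)"
        using T_form_anti[of u \<one>] by (simp add: cong_def mult_2 mod_eq_0_iff_dvd)
      moreover have "coprime p 2"
        using odd by simp
      ultimately have "p dvd T (form u \<one>)"
        by (simp add: coprime_dvd_mult_right_iff)
      then show False
        using T_less[of "form u \<one>"] T_form_u by (auto dest: dvd_imp_le)
    qed
    then have "coprime i p"
      using prime prime_imp_coprime coprime_commute by blast
    then obtain j where j: "[i * j = 1] (mod p)"
      using cong_solve_coprime_nat by auto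
    have pow_W: "x [^]\<^bsub>H\<^esub> (k::nat) \<in> W" if "x \<in> W" for x k
      using that by (induction k) auto
    \<comment> \<open>One nontrivial central element generates the centre: the exponent
      \<open>j * k\<close>, with \<open>j\<close> inverse to \<open>i\<close> modulo
      \<open>p\<close>, reaches \<open>k\<close>.\<close>
    have center: "(\<zero>, k) \<in> W" if "k < p" for k
    proof -
      have "[i * j * k = 1 * k] (mod p)"
        using j by (rule cong_scalar_right)
      then have "(i * j * k) mod p = k"
        using that by (simp add: cong_def)
      moreover have "(\<zero>, i mod p) [^]\<^bsub>H\<^esub> (j * k) = (\<zero>, (i * j * k) mod p)"
      proof -
        have "(\<zero>, i mod p) [^]\<^bsub>H\<^esub> (j * k) = (\<zero>, (j * k * (i mod p)) mod p)"
          using p_pos by (simp add: pow_H)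
        also have "(j * k * (i mod p)) mod p = (j * k * i) mod p"
          by (rule mod_mult_right_eq)
        also have "j * k * i = i * j * k"
          by (simp add: ac_simps)
        finally show ?thesis .
      qed
      ultimately show ?thesis
        using pow_W[OF ziW, of "j * k"] by simp
    qed
    have "x \<in> W" if "x \<in> carrier H" for x
    proof -
      obtain v k where x: "x = (v, k)" "v \<in> carrier R" "k < p"
        using \<open>x \<in> carrier H\<close> by (auto simp: carrier_H)
      obtain l where l: "(v, l) \<in> W"
        using lift[OF x(2)] by blast
      \<comment> \<open>A lift of \<open>v\<close> is corrected by the central element with second
        component \<open>k - l\<close> modulo \<open>p\<close>; no cocycle term arises, since the
        form vanishes when one argument is zero.\<close>
      then have "(v, l) \<otimes>\<^bsub>H\<^esub> (\<zero>, (k + (p - l)) mod p) \<in> W"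
        using center[of "(k + (p - l)) mod p"] p_pos by (intro W.m_closed) auto
      moreover have "l < p"
        using l WH by blast
      then have "l + (k + (p - l)) = k + p"
        by simp
      then have "(l + (k + (p - l)) mod p) mod p = k"
        using x(3) by (simp only: mod_add_right_eq) simp
      then have "(v, l) \<otimes>\<^bsub>H\<^esub> (\<zero>, (k + (p - l)) mod p) = (v, k)"
        using x(2) by (simp only: mult_H form_zero_right T_zero r_zero add_0_right)
      ultimately show ?thesis
        using x by simp
    qed
    then have "W = carrier H"
      using W.subset by blast
    with proper show ?thesis by simp
  qed
qed

end

subsection \<open>Favorable groups\<close>

lemma (in group) AutoGroup_pow_apply:
  assumes f: "f \<in> auto G" and x: "x \<in> carrier G"
  shows "(f [^]\<^bsub>AutoGroup G\<^esub> (k::nat)) x = (f ^^ k) x"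
proof (induction k)
  case 0
  then show ?case
    using x by (simp add: AutoGroup_def BijGroup_def)
next
  case (Suc k)
  interpret A: group "AutoGroup G" by (rule AutoGroup)
  have fA: "f \<in> carrier (AutoGroup G)"
    using f by (simp add: AutoGroup_def)
  have Bij: "g \<in> Bij (carrier G)" if "g \<in> carrier (AutoGroup G)" for g
    using that by (simp add: AutoGroup_def auto_def)
  have "f [^]\<^bsub>AutoGroup G\<^esub> Suc k = f \<otimes>\<^bsub>AutoGroup G\<^esub> f [^]\<^bsub>AutoGroup G\<^esub> k"
    by (rule A.nat_pow_Suc2[OF fA])
  also have "\<dots> = compose (carrier G) f (f [^]\<^bsub>AutoGroup G\<^esub> k)"
    using Bij[OF fA] Bij[OF A.nat_pow_closed[OF fA, of k]] by (simp add: AutoGroup_def BijGroup_def)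
  finally show ?case
    using Suc x by (simp add: compose_def)
qed

lemma (in group) AutoGroup_pow_eq_one_iff:
  assumes f: "f \<in> auto G"
  shows "f [^]\<^bsub>AutoGroup G\<^esub> (k::nat) = \<one>\<^bsub>AutoGroup G\<^esub> \<longleftrightarrow> (\<forall>x\<in>carrier G. (f ^^ k) x = x)"
proof -
  interpret A: group "AutoGroup G" by (rule AutoGroup)
  have "f [^]\<^bsub>AutoGroup G\<^esub> k \<in> carrier (AutoGroup G)"
    using f by (intro A.nat_pow_closed) (simp add: AutoGroup_def)
  then have ext: "f [^]\<^bsub>AutoGroup G\<^esub> k \<in> extensional (carrier G)"
    by (simp add: AutoGroup_def auto_def Bij_def)
  have one: "\<one>\<^bsub>AutoGroup G\<^esub> = (\<lambda>x\<in>carrier G. x)"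
    by (simp add: AutoGroup_def BijGroup_def)
  show ?thesis
  proof
    assume "f [^]\<^bsub>AutoGroup G\<^esub> k = \<one>\<^bsub>AutoGroup G\<^esub>"
    then show "\<forall>x\<in>carrier G. (f ^^ k) x = x"
      using AutoGroup_pow_apply[OF f, of _ k] by (auto simp: one)
  next
    assume "\<forall>x\<in>carrier G. (f ^^ k) x = x"
    then show "f [^]\<^bsub>AutoGroup G\<^esub> k = \<one>\<^bsub>AutoGroup G\<^esub>"
      unfolding one using ext AutoGroup_pow_apply[OF f, of _ k]
      by (intro extensionalityI[of _ "carrier G"]) auto
  qed
qed

text \<open>A divisor of a number prime to \<open>p\<close> is prime to \<open>p\<close>, so any
  \<open>m\<close> that kills \<open>f\<close> may replace the exact order. In this form the
  condition passes easily through an isomorphism.\<close>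

lemma (in group) coprime_automorphism_iff:
  "coprime_automorphism p G f \<longleftrightarrow>
    f \<in> auto G \<and> (\<exists>m. coprime m p \<and> (\<forall>x\<in>carrier G. (f ^^ m) x = x))"
proof -
  interpret A: group "AutoGroup G" by (rule AutoGroup)
  have car: "f \<in> carrier (AutoGroup G) \<longleftrightarrow> f \<in> auto G"
    by (simp add: AutoGroup_def)
  have "coprime (A.ord f) p \<longleftrightarrow> (\<exists>m. coprime m p \<and> (\<forall>x\<in>carrier G. (f ^^ m) x = x))"
    if f: "f \<in> auto G"
  proof
    assume "coprime (A.ord f) p"
    moreover have "\<forall>x\<in>carrier G. (f ^^ A.ord f) x = x"
      using A.pow_ord_eq_1[of f] f car AutoGroup_pow_eq_one_iff[OF f] by blast
    ultimately show "\<exists>m. coprime m p \<and> (\<forall>x\<in>carrier G. (f ^^ m) x = x)"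
      by blast
  next
    assume "\<exists>m. coprime m p \<and> (\<forall>x\<in>carrier G. (f ^^ m) x = x)"
    then obtain m where m: "coprime m p" and "f [^]\<^bsub>AutoGroup G\<^esub> m = \<one>\<^bsub>AutoGroup G\<^esub>"
      using AutoGroup_pow_eq_one_iff[OF f] by blast
    then have "A.ord f dvd m"
      using A.pow_eq_id[of f m] f car by blast
    with m show "coprime (A.ord f) p"
      by (rule coprime_divisors[OF _ dvd_refl, rotated])
  qed
  then show ?thesis
    unfolding coprime_automorphism_def car by blast
qed

lemma (in group) eq_one_AutoGroup_iff:
  assumes "f \<in> auto G"
  shows "f = \<one>\<^bsub>AutoGroup G\<^esub> \<longleftrightarrow> (\<forall>x\<in>carrier G. f x = x)"
proof -
  interpret A: group "AutoGroup G" by (rule AutoGroup)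
  have "f [^]\<^bsub>AutoGroup G\<^esub> (1::nat) = f"
    using assms by (intro A.nat_pow_eone) (simp add: AutoGroup_def)
  then show ?thesis
    using AutoGroup_pow_eq_one_iff[OF assms, of 1] by simp
qed

text \<open>The automorphism is conjugated by the isomorphism, which carries proper invariant
  subgroups to proper invariant subgroups.\<close>

lemma favorable_iso:
  assumes fav: "favorable p H" and G: "group G" and f: "f \<in> iso G H"
  shows "favorable p G"
proof -
  interpret G: group G by (rule G)
  interpret H: group H using fav by (simp add: favorable_def p_group_def)
  have hom: "f \<in> hom G H" and bij: "bij_betw f (carrier G) (carrier H)"
    using f by (auto simp: iso_def)
  interpret f: group_hom G H f
    using hom by (simp add: group_hom_def group_hom_axioms_def G H.group_axioms)
  define g where "g = inv_into (carrier G) f"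
  have g_bij: "bij_betw g (carrier H) (carrier G)"
    unfolding g_def by (rule bij_betw_inv_into[OF bij])
  have fg: "f (g y) = y" if "y \<in> carrier H" for y
    unfolding g_def by (rule bij_betw_inv_into_right[OF bij that])
  have gf: "g (f x) = x" if "x \<in> carrier G" for x
    unfolding g_def by (rule bij_betw_inv_into_left[OF bij that])
  have g_closed: "g y \<in> carrier G" if "y \<in> carrier H" for y
    using g_bij that by (auto simp: bij_betw_def)
  have g_mult: "g (x \<otimes>\<^bsub>H\<^esub> y) = g x \<otimes>\<^bsub>G\<^esub> g y" if "x \<in> carrier H" "y \<in> carrier H" for x y
    using G.iso_set_sym[OF f] that by (auto simp: iso_def hom_def g_def)
  from fav have "\<exists>\<phi>. coprime_automorphism p H \<phi> \<and> \<phi> \<noteq> \<one>\<^bsub>AutoGroup H\<^esub> \<and>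
      (\<forall>K. subgroup K H \<and> K \<noteq> carrier H \<and> \<phi> ` K = K \<longrightarrow> (\<forall>h\<in>K. \<phi> h = h))"
    by (simp only: favorable_def)
  then obtain \<phi> where co: "coprime_automorphism p H \<phi>" and ne: "\<phi> \<noteq> \<one>\<^bsub>AutoGroup H\<^esub>"
    and fix_proper: "\<forall>K. subgroup K H \<and> K \<noteq> carrier H \<and> \<phi> ` K = K \<longrightarrow> (\<forall>h\<in>K. \<phi> h = h)"
    by (elim exE conjE)
  obtain m where \<phi>: "\<phi> \<in> auto H" and m: "coprime m p" and \<phi>m: "\<And>y. y \<in> carrier H \<Longrightarrow> (\<phi> ^^ m) y = y"
    using iffD1[OF H.coprime_automorphism_iff co] by metis
  have \<phi>_hom: "\<phi> \<in> hom H H" and \<phi>_bij: "bij_betw \<phi> (carrier H) (carrier H)"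
    using \<phi> by (auto simp: auto_def Bij_def)
  have \<phi>_closed: "\<phi> y \<in> carrier H" if "y \<in> carrier H" for y
    using \<phi>_hom that by (auto simp: hom_def)
  have \<phi>_mult: "\<phi> (x \<otimes>\<^bsub>H\<^esub> y) = \<phi> x \<otimes>\<^bsub>H\<^esub> \<phi> y" if "x \<in> carrier H" "y \<in> carrier H" for x y
    using \<phi>_hom that by (auto simp: hom_def)
  \<comment> \<open>The restriction to the carrier is needed because elements of
    \<open>auto G\<close> are extensional.\<close>
  define \<psi> where "\<psi> = (\<lambda>x\<in>carrier G. g (\<phi> (f x)))"
  have \<psi>_apply: "\<psi> x = g (\<phi> (f x))" if "x \<in> carrier G" for x
    using that by (simp add: \<psi>_def)
  have f\<psi>: "f (\<psi> x) = \<phi> (f x)" if "x \<in> carrier G" for x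
    using that by (simp add: \<psi>_apply fg \<phi>_closed)
  have \<psi>_closed: "\<psi> x \<in> carrier G" if "x \<in> carrier G" for x
    using that by (simp add: \<psi>_apply g_closed \<phi>_closed)
  have "\<psi> \<in> hom G G"
    by (rule homI) (auto simp: \<psi>_apply g_closed \<phi>_closed \<phi>_mult g_mult)
  moreover have "bij_betw \<psi> (carrier G) (carrier G)"
  proof -
    have "bij_betw (g \<circ> (\<phi> \<circ> f)) (carrier G) (carrier G)"
      using bij_betw_trans[OF bij_betw_trans[OF bij \<phi>_bij] g_bij] .
    then show ?thesis
      using bij_betw_cong[of "carrier G" \<psi> "g \<circ> (\<phi> \<circ> f)" "carrier G"] by (simp add: \<psi>_apply)
  qed
  ultimately have \<psi>: "\<psi> \<in> auto G"
    by (simp add: auto_def Bij_def \<psi>_def)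
  have "(\<psi> ^^ k) x \<in> carrier G \<and> f ((\<psi> ^^ k) x) = (\<phi> ^^ k) (f x)" if "x \<in> carrier G" for x k
    using that by (induction k) (simp_all add: f\<psi> \<psi>_closed)
  then have "(\<psi> ^^ m) x = x" if "x \<in> carrier G" for x
    using that \<phi>m gf by (metis f.hom_closed)
  then have co\<psi>: "coprime_automorphism p G \<psi>"
    using \<psi> m unfolding G.coprime_automorphism_iff by blast
  have "\<psi> \<noteq> \<one>\<^bsub>AutoGroup G\<^esub>"
  proof
    assume "\<psi> = \<one>\<^bsub>AutoGroup G\<^esub>"
    then have id: "\<psi> x = x" if "x \<in> carrier G" for x
      using that G.eq_one_AutoGroup_iff[OF \<psi>] by blast
    have "\<phi> y = y" if "y \<in> carrier H" for y
      using f\<psi>[OF g_closed[OF that]] id[OF g_closed[OF that]] fg[OF that] by simp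
    with ne show False
      using H.eq_one_AutoGroup_iff[OF \<phi>] by blast
  qed
  moreover have "\<psi> h = h" if K: "subgroup K G" and proper: "K \<noteq> carrier G" and inv: "\<psi> ` K = K" and h: "h \<in> K"
    for K h
  proof -
    have KG: "K \<subseteq> carrier G"
      using K by (rule subgroup.subset)
    have "subgroup (f ` K) H"
      using f.subgroup_img_is_subgroup[OF K] .
    moreover have "f ` K \<noteq> carrier H"
    proof
      assume "f ` K = carrier H"
      then have "g ` f ` K = carrier G"
        using g_bij by (simp add: bij_betw_def)
      moreover have "(\<lambda>x. g (f x)) ` K = (\<lambda>x. x) ` K"
        using KG gf by (intro image_cong) auto
      then have "g ` f ` K = K"
        by (simp add: image_image)
      ultimately show False using proper by simp
    qed
    moreover have "\<phi> ` f ` K = f ` K"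
    proof -
      have "(\<lambda>x. \<phi> (f x)) ` K = (\<lambda>x. f (\<psi> x)) ` K"
        using KG f\<psi> by (intro image_cong) auto
      then have "\<phi> ` f ` K = f ` \<psi> ` K"
        by (simp add: image_image)
      then show ?thesis using inv by simp
    qed
    ultimately have "\<phi> (f h) = f h"
      using fix_proper[rule_format, of "f ` K" "f h"] h by simp
    then show ?thesis
      using subsetD[OF KG h] gf by (simp add: \<psi>_apply)
  qed
  moreover have "p_group p G"
    using fav bij_betw_same_card[OF bij] bij_betw_finite[OF bij] G
    by (simp add: favorable_def p_group_def order_def)
  ultimately show ?thesis
    using co\<psi> unfolding favorable_def by blast
qed

lemma (in singer_heisenberg) favorable_H: "favorable p H"
proof -
  have "coprime (p ^ n + 1) p"
  proof -
    \<comment> \<open>Consecutive numbers are coprime; passing from \<open>p^n\<close> to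
      \<open>p\<close> uses \<open>n > 0\<close>.\<close>
    have "coprime (p ^ n + 1) (p ^ n)"
      using coprime_Suc_left_nat[of "p ^ n"] by (simp only: Suc_eq_plus1)
    then show ?thesis
      using n_pos by (auto simp only: coprime_power_right_iff)
  qed
  then have "coprime_automorphism p H \<phi>"
    unfolding H.coprime_automorphism_iff using \<phi>_auto \<phi>_pow_order by blast
  moreover have "\<phi> \<noteq> \<one>\<^bsub>AutoGroup H\<^esub>"
  proof
    assume "\<phi> = \<one>\<^bsub>AutoGroup H\<^esub>"
    then have "\<phi> (\<one>, 0) = (\<one>, 0)"
      using H.eq_one_AutoGroup_iff[OF \<phi>_auto] p_pos by (simp add: carrier_H)
    then show False
      using \<phi>_apply[of \<one> 0] p_pos u_not_one by simp
  qed
  moreover have "p_group p H"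
    unfolding p_group_def order_def card_H
    using prime finite_carrier H.group_axioms by (simp only: carrier_H) blast
  ultimately show ?thesis
    unfolding favorable_def using \<phi>_fixes_proper by blast
qed

lemma exists_favorable_special_p_group:
  assumes "Factorial_Ring.prime p" "odd p" "n > 0"
  obtains H :: "((((int list \<times> nat) multiset \<Rightarrow> int) \<times> nat) monoid)" and z
  where "special_p_group H p z" "card (carrier H) = p ^ (2 * n + 1)" "favorable p H"
proof -
  obtain K :: "((int list \<times> nat) multiset \<Rightarrow> int) ring" and u where "singer_field K p n u"
    using exists_singer_field[OF assms] by blast
  then interpret K: singer_field K p n u .
  obtain T where "singer_heisenberg K p n u T"
    using K.exists_trace K.singer_field_axioms
    by (metis singer_heisenberg.intro singer_heisenberg_axioms.intro)
  then interpret singer_heisenberg K p n u T .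
  show thesis
    using that special_H card_H favorable_H by blast
qed

text \<open>The centre has prime order, so any nontrivial \<open>z\<close> in it generates it, and
  commutators lie in the derived subgroup, which is the centre. Order at most \<open>p\<close> would
  make the group abelian and its derived subgroup trivial; this is what later excludes
  \<open>n = 0\<close>.\<close>

lemma extra_special_imp_special_p_group:
  assumes G: "extra_special p G" and exponent: "group_exponent G = p"
  obtains z where "special_p_group G p z" "p < card (carrier G)"
proof -
  have p: "Factorial_Ring.prime p" and "group G" and fin: "finite (carrier G)"
    and derived: "derived G (carrier G) = center G" and card: "card (center G) = p"
    using G by (auto simp: extra_special_def p_group_def order_def)
  interpret group G by fact
  have center_eq: "center G = {z \<in> carrier G. \<forall>g\<in>carrier G. z \<otimes>\<^bsub>G\<^esub> g = g \<otimes>\<^bsub>G\<^esub> z}"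
    by (rule center_def)
  have center_sub: "subgroup (center G) G"
    using derived_is_subgroup[of "carrier G"] derived by simp
  have exp_p: "x [^]\<^bsub>G\<^esub> p = \<one>\<^bsub>G\<^esub>" if "x \<in> carrier G" for x
  proof -
    have "0 < group_exponent G \<and> (\<forall>x\<in>carrier G. x [^]\<^bsub>G\<^esub> group_exponent G = \<one>\<^bsub>G\<^esub>)"
      unfolding group_exponent_def
    \<comment> \<open>The group order witnesses that some positive exponent exists, so the least one
      has the defining property.\<close>
    proof (rule LeastI)
      show "0 < order G \<and> (\<forall>x\<in>carrier G. x [^]\<^bsub>G\<^esub> order G = \<one>\<^bsub>G\<^esub>)"
        using pow_order_eq_1 fin order_gt_0_iff_finite by blast
    qed
    then show ?thesis
      using that exponent by simp
  qed
  have "center G \<noteq> {\<one>\<^bsub>G\<^esub>}"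
    using card prime_gt_1_nat[OF p] by auto
  then obtain z where z: "z \<in> center G" "z \<noteq> \<one>\<^bsub>G\<^esub>"
    using subgroup.one_closed[OF center_sub] by blast
  then have zG: "z \<in> carrier G"
    by (simp add: center_eq)
  have "ord z dvd p"
    using exp_p[OF zG] pow_eq_id[OF zG] by simp
  then have ord_z: "ord z = p"
    using ord_eq_1[OF zG] z(2) p by (metis prime_nat_iff)
  have z_pow: "z [^]\<^bsub>G\<^esub> (i::nat) \<in> center G" for i
    using subgroup.m_closed[OF center_sub] subgroup.one_closed[OF center_sub] z(1)
    by (induction i) auto
  have "inj_on (\<lambda>i::nat. z [^]\<^bsub>G\<^esub> i) {0..ord z - 1}"
    by (rule ord_inj[OF zG])
  then have "card ((\<lambda>i::nat. z [^]\<^bsub>G\<^esub> i) ` {0..p - 1}) = p"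
    using prime_gt_0_nat[OF p] by (simp add: card_image ord_z)
  then have center_pow: "(\<lambda>i::nat. z [^]\<^bsub>G\<^esub> i) ` {0..p - 1} = center G"
    using z_pow card fin by (intro card_subset_eq) (auto simp: center_eq)
  have "special_p_group G p z"
  proof
    show "Factorial_Ring.prime p" "finite (carrier G)" "z \<in> carrier G" "z \<noteq> \<one>\<^bsub>G\<^esub>"
      by fact+
    show "x [^]\<^bsub>G\<^esub> p = \<one>\<^bsub>G\<^esub>" "z \<otimes>\<^bsub>G\<^esub> x = x \<otimes>\<^bsub>G\<^esub> z" if "x \<in> carrier G" for x
      using exp_p[OF that] z(1) that by (auto simp: center_eq)
    show "\<exists>i::nat. c = z [^]\<^bsub>G\<^esub> i"
      if "c \<in> carrier G" "\<And>x. x \<in> carrier G \<Longrightarrow> c \<otimes>\<^bsub>G\<^esub> x = x \<otimes>\<^bsub>G\<^esub> c" for c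
    proof -
      have "c \<in> center G"
        using that by (simp add: center_eq)
      then show ?thesis
        unfolding center_pow[symmetric] by blast
    qed
    show "\<exists>i::nat. x \<otimes>\<^bsub>G\<^esub> y = y \<otimes>\<^bsub>G\<^esub> x \<otimes>\<^bsub>G\<^esub> z [^]\<^bsub>G\<^esub> i"
      if x: "x \<in> carrier G" and y: "y \<in> carrier G" for x y
    proof -
      \<comment> \<open>The commutator in the shape used by \<open>derived\<close>; being central,
        it can be moved to the right of \<open>y x\<close>.\<close>
      define c where "c = x \<otimes>\<^bsub>G\<^esub> y \<otimes>\<^bsub>G\<^esub> inv\<^bsub>G\<^esub> x \<otimes>\<^bsub>G\<^esub> inv\<^bsub>G\<^esub> y"
      have "c \<in> derived G (carrier G)"
        unfolding c_def derived_def using x y by (intro generate.incl) blast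
      then have c: "c \<in> center G"
        using derived by simp
      have "x \<otimes>\<^bsub>G\<^esub> y = c \<otimes>\<^bsub>G\<^esub> (y \<otimes>\<^bsub>G\<^esub> x)"
        using x y by (simp add: c_def m_assoc) (simp flip: m_assoc)
      also have "\<dots> = (y \<otimes>\<^bsub>G\<^esub> x) \<otimes>\<^bsub>G\<^esub> c"
        using c x y by (simp add: center_eq)
      finally show ?thesis
        using c unfolding center_pow[symmetric] by blast
    qed
  qed
  moreover have "p < card (carrier G)"
  proof (rule ccontr)
    assume "\<not> p < card (carrier G)"
    moreover have sub: "center G \<subseteq> carrier G"
      by (auto simp: center_eq)
    ultimately have "center G = carrier G"
      using card fin by (intro card_seteq) auto
    then have comm: "x \<otimes>\<^bsub>G\<^esub> y = y \<otimes>\<^bsub>G\<^esub> x" if "x \<in> carrier G" "y \<in> carrier G" for x y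
      using that by (auto simp: center_eq)
    have "derived G (carrier G) \<subseteq> {\<one>\<^bsub>G\<^esub>}"
      unfolding derived_def
    proof (rule generate_subgroup_incl[OF _ triv_subgroup])
      show "(\<Union>x\<in>carrier G. \<Union>y\<in>carrier G. {x \<otimes>\<^bsub>G\<^esub> y \<otimes>\<^bsub>G\<^esub> inv\<^bsub>G\<^esub> x \<otimes>\<^bsub>G\<^esub> inv\<^bsub>G\<^esub> y}) \<subseteq> {\<one>\<^bsub>G\<^esub>}"
      proof clarify
        fix x y assume "x \<in> carrier G" "y \<in> carrier G"
        then show "x \<otimes>\<^bsub>G\<^esub> y \<otimes>\<^bsub>G\<^esub> inv\<^bsub>G\<^esub> x \<otimes>\<^bsub>G\<^esub> inv\<^bsub>G\<^esub> y = \<one>\<^bsub>G\<^esub>"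
          using comm[of x y] by (simp add: m_assoc)
      qed
    qed
    then have "card (center G) \<le> 1"
      using derived card_mono[of "{\<one>\<^bsub>G\<^esub>}" "center G"] by simp
    then show False
      using card prime_gt_1_nat[OF p] by simp
  qed
  ultimately show thesis by (rule that)
qed

theorem theorem6p2:
  fixes G :: "('a, 'b) monoid_scheme" and p :: nat
  assumes "Factorial_Ring.prime p" and "odd p"
    and "extra_special p G"
    and "group_exponent G = p"
  shows "favorable p G"
proof -
  obtain z where special: "special_p_group G p z" and p_less: "p < card (carrier G)"
    using extra_special_imp_special_p_group[OF assms(3,4)] .
  obtain n where n: "card (carrier G) = p ^ (2 * n + 1)"
    using special_p_group_order[OF special] by blast
  \<comment> \<open>For \<open>n = 0\<close> the order would be \<open>p\<close>, and the model
    would be built on a field with a single element.\<close>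
  have "n > 0"
    using p_less n by (cases n) auto
  then obtain H :: "((((int list \<times> nat) multiset \<Rightarrow> int) \<times> nat) monoid)" and w where
    H: "special_p_group H p w" "card (carrier H) = p ^ (2 * n + 1)" and fav: "favorable p H"
    using exists_favorable_special_p_group[OF assms(1,2)] by metis
  obtain f where "f \<in> iso G H"
    using special_p_group_iso[OF special H(1)] H(2) n by auto
  moreover have "group G"
    using special by (simp add: special_p_group_def)
  ultimately show ?thesis
    using favorable_iso[OF fav] by blast
qed

end
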